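(* Let $I=(-r,r)$ with $r>0$ and let $c\colon I\to\mathbb{R}^4_2$ be a real analytic curve which is positive, i.e. $\langle c'(t),c'(t)\rangle>0$ for all $t\in I$ (respectively negative, i.e. $\langle c'(t),c'(t)\rangle<0$ for all $t\in I$). Then there exists a connected and simply connected open set $M\subset\mathbb{C}$ with $I\subset M$, to which $c$ has a (unique) holomorphic extension $C\colon M\to\mathbb{C}^4$, such that the map $f\colon M\to\mathbb{R}^4_2$, $$f(w)=c(0)+\mathrm{Re}\int_0^w\bigl(C'(\xi)-iL(C'(\xi))\bigr)\,d\xi ,$$ is a conformal immersion satisfying: (1) $f(t,0)=c(t)$ for each $t\in I$; (2) the mean curvature vector $H_f$ vanishes identically on $M$; (3) $[f_w(w)]\in Q^2_{pos}$ (respectively $[f_w(w)]\in Q^2_{neg}$) for each $w\in M$, and $f$ is isoclinic to $\pi_{34}$ (respectively $\pi_{12}$). Moreover, $f$ is the unique conformal immersion $M\to\mathbb{R}^4_2$ satisfying (1), (2) and (3).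
   Context: $\mathbb{R}^4_2$ is $\mathbb{R}^4$ with $\langle v,w\rangle=-v^1w^1-v^2w^2+v^3w^3+v^4w^4$ and canonical basis $e_1,\dots,e_4$; $\pi_{12}=\mathrm{span}\{e_1,e_2\}$, $\pi_{34}=\mathrm{span}\{e_3,e_4\}$; $\hat v=v^1e_1+v^2e_2$ and $\tilde v=v^3e_3+v^4e_4$ are the projections of $v$ onto $\pi_{12}$ and $\pi_{34}$. A plane is positive (negative) if the induced metric on it is positive (negative) definite. $L$ is the linear map $L(v^1,v^2,v^3,v^4)=(-v^2,v^1,-v^4,v^3)$, extended complex-linearly to $\mathbb{C}^4$. On $\mathbb{C}^4$, $\ll\cdot,\cdot\gg$ is the complex-bilinear extension of $\langle\cdot,\cdot\rangle$. $Q^2_{pos}$ (resp. $Q^2_{neg}$) is the set of $[z]\in\mathbb{C}P^3$ with $\ll z,z\gg=0$ and $\ll z,\bar z\gg>0$ (resp. $<0$). For a map $f$ on an open set $M\subset\mathbb{C}$ with coordinate $w=u+iv$, $f_w=\frac12(f_u-if_v)$; points $u+iv$ of $M$ are also written $(u,v)$. Maps and immersions are smooth. Isoclinic: a negative plane $V$ with basis $\{v,w\}$ satisfying $\langle v,v\rangle=\langle w,w\rangle=-1$, $\langle v,w\rangle=0$ is isoclinic to $\pi_{12}$ if, for $x(\theta)=\cos\theta\, v+\sin\theta\, w$, the function $\theta\mapsto\langle\hat x(\theta),x(\theta)\rangle$ is constant. A positive plane with basis $\{v,w\}$ satisfying $\langle v,v\rangle=\langle w,w\rangle=1$, $\langle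 v,w\rangle=0$ is isoclinic to $\pi_{34}$ if $\theta\mapsto\langle\tilde x(\theta),x(\theta)\rangle$ is constant. A conformal immersion $f$ is isoclinic to $\pi_{34}$ (resp. $\pi_{12}$) if all its tangent planes are positive (resp. negative) and isoclinic to $\pi_{34}$ (resp. $\pi_{12}$), with the orientation convention that at every point the pair $(\hat f_u,\hat f_v)$, if linearly independent, is positively oriented with respect to $(e_1,e_2)$, and the pair $(\tilde f_u,\tilde f_v)$, if linearly independent, is positively oriented with respect to $(e_3,e_4)$. *)

theory Defs
  imports "HOL-Complex_Analysis.Complex_Analysis"
begin

section \<open>The space of signature (2,2) and its complexification\<close>

text \<open>Polymorphic: on \<open>real^4\<close> this is the neutral metric, on \<open>complex^4\<close> it is the
  complex-\<^emph>\<open>bilinear\<close> (not Hermitian) extension of that metric.\<close>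

definition ip22 :: "'a::comm_ring_1^4 \<Rightarrow> 'a^4 \<Rightarrow> 'a"  (\<open>\<langle>\<langle>_,/ _\<rangle>\<rangle>\<close>)
  where "\<langle>\<langle>v, w\<rangle>\<rangle> = - (v$1 * w$1) - v$2 * w$2 + v$3 * w$3 + v$4 * w$4"

text \<open>On \<open>complex^4\<close> this is the complex-linear extension of the map on \<open>real^4\<close>.\<close>

definition Lmap :: "'a::comm_ring_1^4 \<Rightarrow> 'a^4"
  where "Lmap v = vector [- (v$2), v$1, - (v$4), v$3]"

definition proj12 :: "real^4 \<Rightarrow> real^4"
  where "proj12 v = (v$1) *\<^sub>R axis 1 1 + (v$2) *\<^sub>R axis 2 1"

definition proj34 :: "real^4 \<Rightarrow> real^4"
  where "proj34 v = (v$3) *\<^sub>R axis 3 1 + (v$4) *\<^sub>R axis 4 1"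

definition cnj_vec :: "complex^4 \<Rightarrow> complex^4"
  where "cnj_vec z = (\<chi> j. cnj (z$j))"

definition Re_vec :: "complex^4 \<Rightarrow> real^4"
  where "Re_vec z = (\<chi> j. Re (z$j))"

definition cplx_vec :: "real^4 \<Rightarrow> complex^4"
  where "cplx_vec v = (\<chi> j. complex_of_real (v$j))"

definition positive_plane :: "(real^4) set \<Rightarrow> bool"
  where "positive_plane V \<longleftrightarrow> subspace V \<and> dim V = 2 \<and> (\<forall>x\<in>V. x \<noteq> 0 \<longrightarrow> \<langle>\<langle>x, x\<rangle>\<rangle> > 0)"

definition negative_plane :: "(real^4) set \<Rightarrow> bool"
  where "negative_plane V \<longleftrightarrow> subspace V \<and> dim V = 2 \<and> (\<forall>x\<in>V. x \<noteq> 0 \<longrightarrow> \<langle>\<langle>x, x\<rangle>\<rangle> < 0)"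

definition isoclinic_plane12 :: "(real^4) set \<Rightarrow> bool"
  where "isoclinic_plane12 V \<longleftrightarrow> negative_plane V \<and>
    (\<exists>v w. V = span {v, w} \<and> \<langle>\<langle>v, v\<rangle>\<rangle> = -1 \<and> \<langle>\<langle>w, w\<rangle>\<rangle> = -1 \<and> \<langle>\<langle>v, w\<rangle>\<rangle> = 0 \<and>
      (let x = (\<lambda>\<theta>::real. cos \<theta> *\<^sub>R v + sin \<theta> *\<^sub>R w)
       in (\<lambda>\<theta>. \<langle>\<langle>proj12 (x \<theta>), x \<theta>\<rangle>\<rangle>) constant_on UNIV))"

definition isoclinic_plane34 :: "(real^4) set \<Rightarrow> bool"
  where "isoclinic_plane34 V \<longleftrightarrow> positive_plane V \<and>
    (\<exists>v w. V = span {v, w} \<and> \<langle>\<langle>v, v\<rangle>\<rangle> = 1 \<and> \<langle>\<langle>w, w\<rangle>\<rangle> = 1 \<and> \<langle>\<langle>v, w\<rangle>\<rangle> = 0 \<and>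
      (let x = (\<lambda>\<theta>::real. cos \<theta> *\<^sub>R v + sin \<theta> *\<^sub>R w)
       in (\<lambda>\<theta>. \<langle>\<langle>proj34 (x \<theta>), x \<theta>\<rangle>\<rangle>) constant_on UNIV))"

definition positively_oriented :: "real^4 \<Rightarrow> real^4 \<Rightarrow> real^4 \<Rightarrow> real^4 \<Rightarrow> bool"
  where "positively_oriented a b x y \<longleftrightarrow>
    (\<exists>p q s t. x = p *\<^sub>R a + q *\<^sub>R b \<and> y = s *\<^sub>R a + t *\<^sub>R b \<and> p * t - q * s > 0)"

text \<open>A point of complex projective 3-space is a complex line in \<open>complex^4\<close>;
  \<open>vec.span\<close> is the span over the complex scalars.\<close>

definition cp_point :: "complex^4 \<Rightarrow> (complex^4) set"
  where "cp_point z = vec.span {z}"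

text \<open>The number \<open>\<langle>\<langle>z, cnj_vec z\<rangle>\<rangle>\<close> is always real, so taking \<open>Re\<close> loses nothing.\<close>

definition Q_pos :: "(complex^4) set set"
  where "Q_pos = {cp_point z | z. z \<noteq> 0 \<and> \<langle>\<langle>z, z\<rangle>\<rangle> = 0 \<and> Re \<langle>\<langle>z, cnj_vec z\<rangle>\<rangle> > 0}"

definition Q_neg :: "(complex^4) set set"
  where "Q_neg = {cp_point z | z. z \<noteq> 0 \<and> \<langle>\<langle>z, z\<rangle>\<rangle> = 0 \<and> Re \<langle>\<langle>z, cnj_vec z\<rangle>\<rangle> < 0}"


section \<open>Surfaces parametrized by open subsets of the complex plane\<close>

definition du :: "(complex \<Rightarrow> real^4) \<Rightarrow> complex \<Rightarrow> real^4"
  where "du f w = frechet_derivative f (at w) 1"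

definition dv :: "(complex \<Rightarrow> real^4) \<Rightarrow> complex \<Rightarrow> real^4"
  where "dv f w = frechet_derivative f (at w) \<i>"

definition dw :: "(complex \<Rightarrow> real^4) \<Rightarrow> complex \<Rightarrow> complex^4"
  where "dw f w = (1/2) *s (cplx_vec (du f w) - \<i> *s cplx_vec (dv f w))"

fun Ck_on :: "nat \<Rightarrow> (complex \<Rightarrow> real^4) \<Rightarrow> complex set \<Rightarrow> bool"
  where "Ck_on 0 f M \<longleftrightarrow> continuous_on M f"
  | "Ck_on (Suc k) f M \<longleftrightarrow>
      (\<forall>w\<in>M. f differentiable (at w)) \<and> Ck_on k (du f) M \<and> Ck_on k (dv f) M"

definition smooth_on :: "(complex \<Rightarrow> real^4) \<Rightarrow> complex set \<Rightarrow> bool"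
  where "smooth_on f M \<longleftrightarrow> (\<forall>k. Ck_on k f M)"

definition immersion_on :: "(complex \<Rightarrow> real^4) \<Rightarrow> complex set \<Rightarrow> bool"
  where "immersion_on f M \<longleftrightarrow> smooth_on f M \<and> (\<forall>w\<in>M. inj (frechet_derivative f (at w)))"

text \<open>The induced metric is a nonvanishing multiple of \<open>du\<^sup>2 + dv\<^sup>2\<close>; it may be
  positive or negative definite.\<close>

definition conformal_immersion_on :: "(complex \<Rightarrow> real^4) \<Rightarrow> complex set \<Rightarrow> bool"
  where "conformal_immersion_on f M \<longleftrightarrow> immersion_on f M \<and>
    (\<forall>w\<in>M. \<langle>\<langle>du f w, du f w\<rangle>\<rangle> = \<langle>\<langle>dv f w, dv f w\<rangle>\<rangle> \<and> \<langle>\<langle>du f w, dv f w\<rangle>\<rangle> = 0 \<and>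
            \<langle>\<langle>du f w, du f w\<rangle>\<rangle> \<noteq> 0)"

definition tangent_plane :: "(complex \<Rightarrow> real^4) \<Rightarrow> complex \<Rightarrow> (real^4) set"
  where "tangent_plane f w = span {du f w, dv f w}"

text \<open>Well defined whenever the induced metric is nondegenerate at \<open>w\<close>, in particular for
  conformal immersions.\<close>

definition normal_part :: "(complex \<Rightarrow> real^4) \<Rightarrow> complex \<Rightarrow> real^4 \<Rightarrow> real^4"
  where "normal_part f w x =
    (THE n. x - n \<in> tangent_plane f w \<and> (\<forall>y\<in>tangent_plane f w. \<langle>\<langle>n, y\<rangle>\<rangle> = 0))"

text \<open>Half the trace, with respect to the induced metric \<open>E du\<^sup>2 + 2 F du dv + G dv\<^sup>2\<close>, of the
  second fundamental form (the normal part of the second derivatives of \<open>f\<close>).\<close>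

definition mean_curvature :: "(complex \<Rightarrow> real^4) \<Rightarrow> complex \<Rightarrow> real^4"
  where "mean_curvature f w =
    (let E = \<langle>\<langle>du f w, du f w\<rangle>\<rangle>; F = \<langle>\<langle>du f w, dv f w\<rangle>\<rangle>; G = \<langle>\<langle>dv f w, dv f w\<rangle>\<rangle>;
         IIuu = normal_part f w (du (du f) w);
         IIuv = normal_part f w (du (dv f) w);
         IIvv = normal_part f w (dv (dv f) w)
     in (1 / (2 * (E * G - F\<^sup>2))) *\<^sub>R (G *\<^sub>R IIuu - (2 * F) *\<^sub>R IIuv + E *\<^sub>R IIvv))"

definition orientation_convention :: "(complex \<Rightarrow> real^4) \<Rightarrow> complex \<Rightarrow> bool"
  where "orientation_convention f w \<longleftrightarrow>
    (proj12 (du f w) \<noteq> proj12 (dv f w) \<and> independent {proj12 (du f w), proj12 (dv f w)} \<longrightarrow>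
       positively_oriented (axis 1 1) (axis 2 1) (proj12 (du f w)) (proj12 (dv f w))) \<and>
    (proj34 (du f w) \<noteq> proj34 (dv f w) \<and> independent {proj34 (du f w), proj34 (dv f w)} \<longrightarrow>
       positively_oriented (axis 3 1) (axis 4 1) (proj34 (du f w)) (proj34 (dv f w)))"

definition isoclinic_on12 :: "(complex \<Rightarrow> real^4) \<Rightarrow> complex set \<Rightarrow> bool"
  where "isoclinic_on12 f M \<longleftrightarrow>
    (\<forall>w\<in>M. isoclinic_plane12 (tangent_plane f w) \<and> orientation_convention f w)"

definition isoclinic_on34 :: "(complex \<Rightarrow> real^4) \<Rightarrow> complex set \<Rightarrow> bool"
  where "isoclinic_on34 f M \<longleftrightarrow>
    (\<forall>w\<in>M. isoclinic_plane34 (tangent_plane f w) \<and> orientation_convention f w)"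


section \<open>Bjorling data\<close>

definition real_analytic_on :: "(real \<Rightarrow> real^4) \<Rightarrow> real set \<Rightarrow> bool"
  where "real_analytic_on c I \<longleftrightarrow>
    (\<forall>t\<in>I. \<exists>a. \<exists>e>0. \<forall>s\<in>I. \<bar>s - t\<bar> < e \<longrightarrow> (\<lambda>n. (s - t) ^ n *\<^sub>R a n) sums c s)"

definition holomorphic_extension :: "(real \<Rightarrow> real^4) \<Rightarrow> real set \<Rightarrow> (complex \<Rightarrow> complex^4) \<Rightarrow> complex set \<Rightarrow> bool"
  where "holomorphic_extension c I C M \<longleftrightarrow>
    (\<forall>j. (\<lambda>w. C w $ j) holomorphic_on M) \<and> (\<forall>t\<in>I. C (of_real t) = cplx_vec (c t))"

definition deriv_vec :: "(complex \<Rightarrow> complex^4) \<Rightarrow> complex \<Rightarrow> complex^4"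
  where "deriv_vec C w = (\<chi> j. deriv (\<lambda>\<xi>. C \<xi> $ j) w)"

text \<open>The common value of the integrals of \<open>F\<close> along all piecewise smooth paths from \<open>a\<close> to \<open>b\<close>
  inside \<open>M\<close>; it exists if \<open>F\<close> is holomorphic, \<open>M\<close> is open and simply connected, and
  \<open>a\<close>, \<open>b\<close> lie in \<open>M\<close>.\<close>

definition integral_within :: "complex set \<Rightarrow> complex \<Rightarrow> complex \<Rightarrow> (complex \<Rightarrow> complex^4) \<Rightarrow> complex^4"
  where "integral_within M a b F =
    (THE y. \<forall>\<gamma>. valid_path \<gamma> \<and> path_image \<gamma> \<subseteq> M \<and> pathstart \<gamma> = a \<and> pathfinish \<gamma> = b \<longrightarrow>
       (\<forall>j. ((\<lambda>\<xi>. F \<xi> $ j) has_contour_integral (y $ j)) \<gamma>))"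

definition bjorling_map :: "complex set \<Rightarrow> (real \<Rightarrow> real^4) \<Rightarrow> (complex \<Rightarrow> complex^4) \<Rightarrow> complex \<Rightarrow> real^4"
  where "bjorling_map M c C w =
    c 0 + Re_vec (integral_within M 0 w (\<lambda>\<xi>. deriv_vec C \<xi> - \<i> *s Lmap (deriv_vec C \<xi>)))"

definition bjorling_pos :: "(real \<Rightarrow> real^4) \<Rightarrow> real set \<Rightarrow> (complex \<Rightarrow> real^4) \<Rightarrow> complex set \<Rightarrow> bool"
  where "bjorling_pos c I f M \<longleftrightarrow>
    conformal_immersion_on f M \<and>
    (\<forall>t\<in>I. f (of_real t) = c t) \<and>
    (\<forall>w\<in>M. mean_curvature f w = 0) \<and>
    (\<forall>w\<in>M. cp_point (dw f w) \<in> Q_pos) \<and> isoclinic_on34 f M"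

definition bjorling_neg :: "(real \<Rightarrow> real^4) \<Rightarrow> real set \<Rightarrow> (complex \<Rightarrow> real^4) \<Rightarrow> complex set \<Rightarrow> bool"
  where "bjorling_neg c I f M \<longleftrightarrow>
    conformal_immersion_on f M \<and>
    (\<forall>t\<in>I. f (of_real t) = c t) \<and>
    (\<forall>w\<in>M. mean_curvature f w = 0) \<and>
    (\<forall>w\<in>M. cp_point (dw f w) \<in> Q_neg) \<and> isoclinic_on12 f M"

end

theory Submission
  imports Defs
begin

text \<open>
  Identify \<open>\<real>\<^sup>4\<close> with \<open>\<complex>\<^sup>2\<close> through \<open>z12 v = v\<^sup>1 + \<i> v\<^sup>2\<close> and \<open>z34 v = v\<^sup>3 + \<i> v\<^sup>4\<close>. Then \<open>L\<close> is
  multiplication by \<open>\<i>\<close>, it is an isometry with \<open>\<langle>v, L v\<rangle> = 0\<close>, and \<open>\<langle>v, v\<rangle> = |z34 v|\<^sup>2 - |z12 v|\<^sup>2\<close>. Integrating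
  the formula for \<open>f\<close> shows that \<open>z12 \<circ> f = C\<^sup>1 + \<i> C\<^sup>2\<close> and \<open>z34 \<circ> f = C\<^sup>3 + \<i> C\<^sup>4\<close>
  (\<open>bjorling_map_coordinates\<close>): \<open>f\<close> is a holomorphic curve in \<open>\<complex>\<^sup>2\<close>, or equivalently \<open>f\<^sub>v = L f\<^sub>u\<close>.

  As long as the metric has the right sign, every required property of \<open>f\<close> follows from this
  (\<open>hol_curve_on_bjorling_pos\<close>, \<open>hol_curve_on_bjorling_neg\<close>). The frame \<open>(f\<^sub>u, L f\<^sub>u)\<close> is conformal, and \<open>f\<close> is
  harmonic, so its mean curvature vanishes. The tangent planes are complex lines: a rotation within
  such a plane multiplies both complex coordinates by the same number of modulus one and so
  preserves the lengths of both projections, which is the isoclinic condition. The sign of the metric is prescribed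
  along \<open>I\<close> and persists on a neighbourhood of \<open>I\<close>. The domain \<open>M\<close> is a union of discs centred on \<open>I\<close>
  inside that neighbourhood: it retracts vertically onto \<open>I\<close>, so it is contractible
  (\<open>simply_connected_neighbourhood\<close>). The extension \<open>C\<close> is glued from complexified power series on
  such discs (\<open>real_analytic_extension\<close>).

  For uniqueness, let \<open>g\<close> be another solution. Since the tangent plane is isoclinic,
  the projections of \<open>g\<^sub>u, g\<^sub>v\<close> onto \<open>\<pi>\<^sub>1\<^sub>2\<close> and onto \<open>\<pi>\<^sub>3\<^sub>4\<close> are both conformal pairs, and by the
  orientation convention each second vector is \<open>\<i>\<close> times the first. So \<open>g\<^sub>v = L g\<^sub>u\<close>, the
  Cauchy-Riemann equations (\<open>isoclinic_imp_hol_curve_on\<close>). Two holomorphic curves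
  that agree along \<open>I\<close> agree on \<open>M\<close> by the identity theorem.
\<close>

(* Formal power series share this infix; here it always denotes components of vectors. *)
no_notation fps_nth (infixl \<open>$\<close> 75)

section \<open>The identification with complex 2-space\<close>

definition z12 :: "real^4 \<Rightarrow> complex"
  where "z12 v = Complex (v$1) (v$2)"

definition z34 :: "real^4 \<Rightarrow> complex"
  where "z34 v = Complex (v$3) (v$4)"

lemma vec4_eq_iff: "v = w \<longleftrightarrow> v$1 = w$1 \<and> v$2 = w$2 \<and> v$3 = w$3 \<and> v$4 = w$(4::4)"
  by (simp add: vec_eq_iff forall_4)

lemma complex_coordinates_eq_iff: "v = w \<longleftrightarrow> z12 v = z12 w \<and> z34 v = z34 w"
  by (auto simp: vec4_eq_iff z12_def z34_def)

lemma Lmap_nth [simp]: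
  "Lmap v $ 1 = - (v$2)" "Lmap v $ 2 = v$1" "Lmap v $ 3 = - (v$4)" "Lmap v $ 4 = v$3"
  by (simp_all add: Lmap_def vector_def)

lemma z12_Lmap: "z12 (Lmap v) = \<i> * z12 v"
  and z34_Lmap: "z34 (Lmap v) = \<i> * z34 v"
  by (simp_all add: z12_def z34_def complex_eq_iff)

lemma bounded_linear_z12: "bounded_linear z12"
  and bounded_linear_z34: "bounded_linear z34"
  by (auto intro!: linear_conv_bounded_linear[THEN iffD1] linearI
      simp: z12_def z34_def complex_eq_iff)

lemma proj_nth [simp]:
  "proj12 v $ 1 = v$1" "proj12 v $ 2 = v$2" "proj12 v $ 3 = 0" "proj12 v $ 4 = 0"
  "proj34 v $ 1 = 0" "proj34 v $ 2 = 0" "proj34 v $ 3 = v$3" "proj34 v $ 4 = v$4"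
  by (simp_all add: proj12_def proj34_def axis_def)

lemma bilinear_ip22: "bilinear (ip22 :: real^4 \<Rightarrow> real^4 \<Rightarrow> real)"
  by (auto simp: bilinear_def ip22_def algebra_simps intro!: linearI)

lemmas ip22_linear =
  bilinear_ladd[OF bilinear_ip22] bilinear_radd[OF bilinear_ip22]
  bilinear_lsub[OF bilinear_ip22] bilinear_rsub[OF bilinear_ip22]
  bilinear_lmul[OF bilinear_ip22] bilinear_rmul[OF bilinear_ip22]

lemma ip22_commute: "\<langle>\<langle>v, w\<rangle>\<rangle> = \<langle>\<langle>w, v\<rangle>\<rangle>"
  by (simp add: ip22_def mult.commute)

lemma ip22_zero [simp]: "\<langle>\<langle>0, v\<rangle>\<rangle> = 0" "\<langle>\<langle>v, 0\<rangle>\<rangle> = 0"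
  by (simp_all add: ip22_def)

lemma ip22_self: "\<langle>\<langle>v, v\<rangle>\<rangle> = (cmod (z34 v))\<^sup>2 - (cmod (z12 v))\<^sup>2"
  by (simp add: ip22_def z12_def z34_def cmod_def power2_eq_square)

lemma ip22_Lmap [simp]: "\<langle>\<langle>Lmap v, Lmap w\<rangle>\<rangle> = \<langle>\<langle>v, w\<rangle>\<rangle>"
  by (simp add: ip22_def)

lemma ip22_Lmap_orthogonal [simp]: "\<langle>\<langle>v, Lmap v\<rangle>\<rangle> = 0"
  by (simp add: ip22_def)

section \<open>Conformal frames of definite planes\<close>

locale conformal_frame =
  fixes x y :: "real^4"
  assumes eq_length: "\<langle>\<langle>y, y\<rangle>\<rangle> = \<langle>\<langle>x, x\<rangle>\<rangle>"
    and orthogonal: "\<langle>\<langle>x, y\<rangle>\<rangle> = 0"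
    and nondegenerate: "\<langle>\<langle>x, x\<rangle>\<rangle> \<noteq> 0"
begin

no_notation fps_nth (infixl \<open>$\<close> 75)

lemma ip22_combination:
  "\<langle>\<langle>a *\<^sub>R x + b *\<^sub>R y, c *\<^sub>R x + d *\<^sub>R y\<rangle>\<rangle> = (a * c + b * d) * \<langle>\<langle>x, x\<rangle>\<rangle>"
  using eq_length orthogonal ip22_commute[of y x] by (simp add: ip22_linear algebra_simps)

lemma frame_distinct: "x \<noteq> y"
  using orthogonal nondegenerate by auto

lemma combination_eq_0:
  assumes "a *\<^sub>R x + b *\<^sub>R y = 0"
  shows "a = 0" "b = 0"
  using ip22_combination[of a b a b] assms nondegenerate
  by (auto simp: sum_squares_eq_zero_iff)

lemma frame_independent: "independent {x, y}"
proof -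
  have "y \<noteq> 0"
    using eq_length nondegenerate by auto
  moreover have "x \<notin> span {y}"
  proof
    assume "x \<in> span {y}"
    then obtain k where "x = k *\<^sub>R y"
      by (auto simp: span_singleton)
    then have "1 *\<^sub>R x + (-k) *\<^sub>R y = 0"
      by simp
    then show False
      using combination_eq_0(1) by fastforce
  qed
  ultimately show ?thesis
    by (simp add: independent_insert)
qed

lemma dim_span_frame: "dim (span {x, y}) = 2"
  using frame_independent frame_distinct by (simp add: dim_eq_card_independent)

lemma in_span_frame: "z \<in> span {x, y} \<longleftrightarrow> (\<exists>a b. z = a *\<^sub>R x + b *\<^sub>R y)"
  by (auto simp: span_insert span_singleton algebra_simps)

lemma ip22_span_sign:
  assumes "z \<in> span {x, y}" "z \<noteq> 0"
  shows "\<exists>k>0. \<langle>\<langle>z, z\<rangle>\<rangle> = k * \<langle>\<langle>x, x\<rangle>\<rangle>"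
proof -
  obtain a b where z: "z = a *\<^sub>R x + b *\<^sub>R y"
    using assms(1) in_span_frame by blast
  with assms(2) have "a \<noteq> 0 \<or> b \<noteq> 0"
    by auto
  then show ?thesis
    using ip22_combination[of a b a b] z sum_squares_gt_zero_iff[of a b] by blast
qed

lemma positive_plane_span:
  assumes "\<langle>\<langle>x, x\<rangle>\<rangle> > 0"
  shows "positive_plane (span {x, y})"
  unfolding positive_plane_def
proof (intro conjI ballI impI subspace_span dim_span_frame)
  fix z assume "z \<in> span {x, y}" "z \<noteq> 0"
  then obtain k where "k > 0" "\<langle>\<langle>z, z\<rangle>\<rangle> = k * \<langle>\<langle>x, x\<rangle>\<rangle>"
    using ip22_span_sign by blast
  then show "\<langle>\<langle>z, z\<rangle>\<rangle> > 0"
    using assms by (simp add: mult_pos_pos)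
qed

lemma negative_plane_span:
  assumes "\<langle>\<langle>x, x\<rangle>\<rangle> < 0"
  shows "negative_plane (span {x, y})"
  unfolding negative_plane_def
proof (intro conjI ballI impI subspace_span dim_span_frame)
  fix z assume "z \<in> span {x, y}" "z \<noteq> 0"
  then obtain k where "k > 0" "\<langle>\<langle>z, z\<rangle>\<rangle> = k * \<langle>\<langle>x, x\<rangle>\<rangle>"
    using ip22_span_sign by blast
  then show "\<langle>\<langle>z, z\<rangle>\<rangle> < 0"
    using assms by (simp add: mult_pos_neg)
qed

lemma orthogonal_span_frame:
  assumes "\<langle>\<langle>n, x\<rangle>\<rangle> = 0" "\<langle>\<langle>n, y\<rangle>\<rangle> = 0"
  shows "\<forall>t\<in>span {x, y}. \<langle>\<langle>n, t\<rangle>\<rangle> = 0"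
  using assms by (auto simp: in_span_frame ip22_linear)

text \<open>The normal part from the definition of mean curvature, in closed form: the tangential part is the
  Fourier expansion in the frame. In particular it depends linearly on \<open>z\<close>.\<close>

lemma normal_component_eq:
  "(THE n. z - n \<in> span {x, y} \<and> (\<forall>t\<in>span {x, y}. \<langle>\<langle>n, t\<rangle>\<rangle> = 0)) =
     z - (\<langle>\<langle>z, x\<rangle>\<rangle> / \<langle>\<langle>x, x\<rangle>\<rangle>) *\<^sub>R x - (\<langle>\<langle>z, y\<rangle>\<rangle> / \<langle>\<langle>x, x\<rangle>\<rangle>) *\<^sub>R y" (is "_ = ?n")
proof (rule the_equality)
  have "z - ?n = (\<langle>\<langle>z, x\<rangle>\<rangle> / \<langle>\<langle>x, x\<rangle>\<rangle>) *\<^sub>R x + (\<langle>\<langle>z, y\<rangle>\<rangle> / \<langle>\<langle>x, x\<rangle>\<rangle>) *\<^sub>R y"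
    by simp
  then have "z - ?n \<in> span {x, y}"
    using in_span_frame by blast
  moreover have "\<langle>\<langle>?n, x\<rangle>\<rangle> = 0" "\<langle>\<langle>?n, y\<rangle>\<rangle> = 0"
    using eq_length orthogonal nondegenerate ip22_commute[of y x]
    by (simp_all add: ip22_linear)
  then have "\<forall>t\<in>span {x, y}. \<langle>\<langle>?n, t\<rangle>\<rangle> = 0"
    by (rule orthogonal_span_frame)
  ultimately show "z - ?n \<in> span {x, y} \<and> (\<forall>t\<in>span {x, y}. \<langle>\<langle>?n, t\<rangle>\<rangle> = 0)" ..
next
  fix n assume n: "z - n \<in> span {x, y} \<and> (\<forall>t\<in>span {x, y}. \<langle>\<langle>n, t\<rangle>\<rangle> = 0)"
  then obtain a b where ab: "z - n = a *\<^sub>R x + b *\<^sub>R y"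
    using in_span_frame by blast
  then have z: "z = n + a *\<^sub>R x + b *\<^sub>R y"
    by (simp add: algebra_simps)
  have "\<langle>\<langle>n, x\<rangle>\<rangle> = 0" "\<langle>\<langle>n, y\<rangle>\<rangle> = 0"
    using n by (simp_all add: span_base)
  then have "\<langle>\<langle>z, x\<rangle>\<rangle> = a * \<langle>\<langle>x, x\<rangle>\<rangle>" "\<langle>\<langle>z, y\<rangle>\<rangle> = b * \<langle>\<langle>x, x\<rangle>\<rangle>"
    using eq_length orthogonal ip22_commute[of y x] by (simp_all add: z ip22_linear)
  then show "n = ?n"
    using nondegenerate z by simp
qed

end

section \<open>Isoclinic planes and complex lines\<close>

text \<open>A quadratic form that is constant on the unit circle of a definite plane is a multiple of the
  metric there (compare the angles \<open>0\<close>, \<open>\<pi>/4\<close> and \<open>\<pi>/2\<close>). So the isoclinic condition, stated for one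
  orthonormal basis of the plane, applies to every conformal pair in it.\<close>

lemma constant_on_circle_imp_conformal:
  fixes B :: "real^4 \<Rightarrow> real^4 \<Rightarrow> real"
  assumes B: "bilinear B" and sym: "\<And>s t. B s t = B t s"
    and const: "(\<lambda>\<theta>. B (cos \<theta> *\<^sub>R v + sin \<theta> *\<^sub>R w) (cos \<theta> *\<^sub>R v + sin \<theta> *\<^sub>R w)) constant_on UNIV"
    and vw: "\<langle>\<langle>v, v\<rangle>\<rangle> = \<epsilon>" "\<langle>\<langle>w, w\<rangle>\<rangle> = \<epsilon>" "\<langle>\<langle>v, w\<rangle>\<rangle> = 0" "\<epsilon> \<noteq> 0"
    and xy: "x \<in> span {v, w}" "y \<in> span {v, w}" "\<langle>\<langle>x, x\<rangle>\<rangle> = \<langle>\<langle>y, y\<rangle>\<rangle>" "\<langle>\<langle>x, y\<rangle>\<rangle> = 0"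
  shows "B x x = B y y" "B x y = 0"
proof -
  interpret conformal_frame v w
    using vw by unfold_locales auto
  note lin = bilinear_ladd[OF B] bilinear_radd[OF B] bilinear_lmul[OF B] bilinear_rmul[OF B]
  obtain K where K: "B (cos \<theta> *\<^sub>R v + sin \<theta> *\<^sub>R w) (cos \<theta> *\<^sub>R v + sin \<theta> *\<^sub>R w) = K" for \<theta>
    using const by (auto simp: constant_on_def)
  have Bv: "B v v = K"
    using K[of 0] by simp
  have Bw: "B w w = K"
    using K[of "pi/2"] by simp
  have "B v w = 0"
    using K[of "pi/4"] sym[of w v]
    by (simp add: lin cos_45 sin_45 Bv Bw algebra_simps flip: power2_eq_square)
  then have Bc: "B (a *\<^sub>R v + b *\<^sub>R w) (c *\<^sub>R v + d *\<^sub>R w) = (a * c + b * d) * K" for a b c d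
    using sym[of w v] by (simp add: lin Bv Bw algebra_simps)
  obtain a b where x: "x = a *\<^sub>R v + b *\<^sub>R w"
    using xy(1) in_span_frame by blast
  obtain c d where y: "y = c *\<^sub>R v + d *\<^sub>R w"
    using xy(2) in_span_frame by blast
  have "a * a + b * b = c * c + d * d" "a * c + b * d = 0"
    using xy(3,4) vw(1,4) unfolding x y ip22_combination by auto
  then show "B x x = B y y" "B x y = 0"
    unfolding x y Bc by simp_all
qed

text \<open>Two orthogonal plane vectors of equal length differ by a quarter turn; the sign of their
  determinant excludes the clockwise one.\<close>

lemma orthogonal_equal_length_complex:
  assumes len: "Re a * Re a + Im a * Im a = Re b * Re b + Im b * Im b"
    and orth: "Re a * Re b + Im a * Im b = 0"
    and orient: "Re a * Im b - Im a * Re b \<noteq> 0 \<Longrightarrow> Re a * Im b - Im a * Re b > 0"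
  shows "b = \<i> * a"
proof (cases "a = 0")
  case True
  then show ?thesis
    using len by (simp add: sum_squares_eq_zero_iff complex_eq_iff)
next
  case False
  define n where "n = Re a * Re a + Im a * Im a"
  define d where "d = Re a * Im b - Im a * Re b"
  have n: "n > 0"
    using False by (simp add: n_def sum_squares_gt_zero_iff complex_eq_iff)
  have "d\<^sup>2 = n\<^sup>2"
  proof -
    \<comment> \<open>Lagrange's identity: the squared determinant and scalar product add up to \<open>|a|\<^sup>2 |b|\<^sup>2\<close>.\<close>
    have "d\<^sup>2 + (Re a * Re b + Im a * Im b)\<^sup>2 = n * (Re b * Re b + Im b * Im b)"
      by (simp add: d_def n_def power2_eq_square algebra_simps)
    then show ?thesis
      using len orth by (simp add: n_def power2_eq_square)
  qed
  then have d: "d = n"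
    using n orient unfolding d_def[symmetric] by (auto simp: power2_eq_iff)
  have "n * Re b = Re a * (Re a * Re b + Im a * Im b) - Im a * d"
       "n * Im b = Im a * (Re a * Re b + Im a * Im b) + Re a * d"
    by (simp_all add: n_def d_def algebra_simps)
  then have "n * Re b = n * (- Im a)" "n * Im b = n * Re a"
    using orth d by simp_all
  then show ?thesis
    using n unfolding mult_cancel_left by (simp add: complex_eq_iff)
qed

lemma independent_if_det:
  fixes x y :: "real^4"
  assumes "x$i * y$j - x$j * y$i \<noteq> 0"
  shows "x \<noteq> y \<and> independent {x, y}"
proof -
  have "y \<noteq> 0" and "x \<noteq> y"
    using assms by auto
  moreover have "x \<notin> span {y}"
    using assms by (auto simp: span_singleton)
  ultimately show ?thesis
    by (simp add: independent_insert)
qed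

lemma positively_oriented12D:
  "positively_oriented (axis 1 1) (axis 2 1) x y \<Longrightarrow> x$1 * y$2 - x$2 * y$1 > 0"
  by (auto simp: positively_oriented_def axis_def)

lemma positively_oriented34D:
  "positively_oriented (axis 3 1) (axis 4 1) x y \<Longrightarrow> x$3 * y$4 - x$4 * y$3 > 0"
  by (auto simp: positively_oriented_def axis_def)

lemma orientation_convention_det:
  assumes "orientation_convention f w"
  shows "z \<in> {z12, z34} \<Longrightarrow> Re (z (du f w)) * Im (z (dv f w)) - Im (z (du f w)) * Re (z (dv f w)) \<noteq> 0 \<Longrightarrow>
     Re (z (du f w)) * Im (z (dv f w)) - Im (z (du f w)) * Re (z (dv f w)) > 0"
  using assms independent_if_det[of "proj12 (du f w)" 1 "proj12 (dv f w)" 2]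
    independent_if_det[of "proj34 (du f w)" 3 "proj34 (dv f w)" 4]
    positively_oriented12D[of "proj12 (du f w)" "proj12 (dv f w)"]
    positively_oriented34D[of "proj34 (du f w)" "proj34 (dv f w)"]
  by (auto simp: orientation_convention_def z12_def z34_def)

lemma orientation_convention_Lmap:
  assumes "dv f w = Lmap (du f w)"
  shows "orientation_convention f w"
proof -
  define x where "x = du f w"
  have "positively_oriented (axis 1 1) (axis 2 1) (proj12 x) (proj12 (Lmap x))"
    if "proj12 x \<noteq> proj12 (Lmap x)"
  proof -
    have "x$1 * x$1 + x$2 * x$2 > 0"
      using that by (auto simp: sum_squares_gt_zero_iff vec4_eq_iff)
    then show ?thesis
      unfolding positively_oriented_def
      by (intro exI[of _ "x$1"] exI[of _ "x$2"] exI[of _ "- x$2"]) (auto simp: proj12_def)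
  qed
  moreover have "positively_oriented (axis 3 1) (axis 4 1) (proj34 x) (proj34 (Lmap x))"
    if "proj34 x \<noteq> proj34 (Lmap x)"
  proof -
    have "x$3 * x$3 + x$4 * x$4 > 0"
      using that by (auto simp: sum_squares_gt_zero_iff vec4_eq_iff)
    then show ?thesis
      unfolding positively_oriented_def
      by (intro exI[of _ "x$3"] exI[of _ "x$4"] exI[of _ "- x$4"]) (auto simp: proj34_def)
  qed
  ultimately show ?thesis
    using assms by (simp add: orientation_convention_def x_def)
qed

lemma normalize_Lmap_frame:
  fixes x :: "real^4"
  assumes "\<langle>\<langle>x, x\<rangle>\<rangle> \<noteq> 0"
  obtains v where "span {v, Lmap v} = span {x, Lmap x}" "\<langle>\<langle>v, v\<rangle>\<rangle> = sgn \<langle>\<langle>x, x\<rangle>\<rangle>"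
proof
  define k where "k = 1 / sqrt \<bar>\<langle>\<langle>x, x\<rangle>\<rangle>\<bar>"
  have k: "k \<noteq> 0"
    using assms by (simp add: k_def)
  have "span ((\<lambda>z. k *\<^sub>R z) ` {x, Lmap x}) = span {x, Lmap x}"
    using k by (intro span_image_scale) auto
  moreover have "Lmap (k *\<^sub>R x) = k *\<^sub>R Lmap x"
    by (simp add: vec4_eq_iff)
  ultimately show "span {k *\<^sub>R x, Lmap (k *\<^sub>R x)} = span {x, Lmap x}"
    by simp
  show "\<langle>\<langle>k *\<^sub>R x, k *\<^sub>R x\<rangle>\<rangle> = sgn \<langle>\<langle>x, x\<rangle>\<rangle>"
  proof -
    have "k * k * \<bar>\<langle>\<langle>x, x\<rangle>\<rangle>\<bar> = 1"
      using assms by (simp add: k_def)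
    then have "k * k * \<langle>\<langle>x, x\<rangle>\<rangle> = sgn \<langle>\<langle>x, x\<rangle>\<rangle>"
      using assms by (cases "\<langle>\<langle>x, x\<rangle>\<rangle> > 0") auto
    then show ?thesis
      by (simp add: ip22_linear)
  qed
qed

text \<open>In a basis \<open>v, L v\<close> the form \<open>|z34|\<^sup>2\<close> is a multiple of the sum of squares of the coordinates, because \<open>L\<close> is
  multiplication by \<open>\<i>\<close>; hence it is constant on the unit circle.\<close>

lemma isoclinic_plane34_Lmap:
  assumes "\<langle>\<langle>x, x\<rangle>\<rangle> > 0"
  shows "isoclinic_plane34 (span {x, Lmap x})"
proof -
  interpret conformal_frame x "Lmap x"
    using assms by unfold_locales auto
  obtain v where v: "span {v, Lmap v} = span {x, Lmap x}" "\<langle>\<langle>v, v\<rangle>\<rangle> = sgn \<langle>\<langle>x, x\<rangle>\<rangle>"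
    by (rule normalize_Lmap_frame[OF nondegenerate])
  have "\<langle>\<langle>proj34 (\<alpha> *\<^sub>R v + \<beta> *\<^sub>R Lmap v), \<alpha> *\<^sub>R v + \<beta> *\<^sub>R Lmap v\<rangle>\<rangle> =
      (\<alpha>\<^sup>2 + \<beta>\<^sup>2) * (v$3 * v$3 + v$4 * v$4)" for \<alpha> \<beta>
    by (simp add: ip22_def power2_eq_square algebra_simps)
  then have "(\<lambda>\<theta>. \<langle>\<langle>proj34 (cos \<theta> *\<^sub>R v + sin \<theta> *\<^sub>R Lmap v), cos \<theta> *\<^sub>R v + sin \<theta> *\<^sub>R Lmap v\<rangle>\<rangle>)
      constant_on UNIV"
    by (simp add: constant_on_def)
  then have "\<exists>v w. span {x, Lmap x} = span {v, w} \<and> \<langle>\<langle>v, v\<rangle>\<rangle> = 1 \<and> \<langle>\<langle>w, w\<rangle>\<rangle> = 1 \<and> \<langle>\<langle>v, w\<rangle>\<rangle> = 0 \<and>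
      (\<lambda>\<theta>. \<langle>\<langle>proj34 (cos \<theta> *\<^sub>R v + sin \<theta> *\<^sub>R w), cos \<theta> *\<^sub>R v + sin \<theta> *\<^sub>R w\<rangle>\<rangle>) constant_on UNIV"
    using v assms by (intro exI[of _ v] exI[of _ "Lmap v"]) simp
  then show ?thesis
    using positive_plane_span[OF assms] by (simp add: isoclinic_plane34_def)
qed

lemma isoclinic_plane12_Lmap:
  assumes "\<langle>\<langle>x, x\<rangle>\<rangle> < 0"
  shows "isoclinic_plane12 (span {x, Lmap x})"
proof -
  interpret conformal_frame x "Lmap x"
    using assms by unfold_locales auto
  obtain v where v: "span {v, Lmap v} = span {x, Lmap x}" "\<langle>\<langle>v, v\<rangle>\<rangle> = sgn \<langle>\<langle>x, x\<rangle>\<rangle>"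
    by (rule normalize_Lmap_frame[OF nondegenerate])
  have "\<langle>\<langle>proj12 (\<alpha> *\<^sub>R v + \<beta> *\<^sub>R Lmap v), \<alpha> *\<^sub>R v + \<beta> *\<^sub>R Lmap v\<rangle>\<rangle> =
      (\<alpha>\<^sup>2 + \<beta>\<^sup>2) * (- (v$1 * v$1 + v$2 * v$2))" for \<alpha> \<beta>
    by (simp add: ip22_def power2_eq_square algebra_simps)
  then have "(\<lambda>\<theta>. \<langle>\<langle>proj12 (cos \<theta> *\<^sub>R v + sin \<theta> *\<^sub>R Lmap v), cos \<theta> *\<^sub>R v + sin \<theta> *\<^sub>R Lmap v\<rangle>\<rangle>)
      constant_on UNIV"
    by (simp add: constant_on_def)
  then have "\<exists>v w. span {x, Lmap x} = span {v, w} \<and> \<langle>\<langle>v, v\<rangle>\<rangle> = -1 \<and> \<langle>\<langle>w, w\<rangle>\<rangle> = -1 \<and> \<langle>\<langle>v, w\<rangle>\<rangle> = 0 \<and>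
      (\<lambda>\<theta>. \<langle>\<langle>proj12 (cos \<theta> *\<^sub>R v + sin \<theta> *\<^sub>R w), cos \<theta> *\<^sub>R v + sin \<theta> *\<^sub>R w\<rangle>\<rangle>) constant_on UNIV"
    using v assms by (intro exI[of _ v] exI[of _ "Lmap v"]) simp
  then show ?thesis
    using negative_plane_span[OF assms] by (simp add: isoclinic_plane12_def)
qed

lemma isoclinic_plane34_conformal:
  assumes "isoclinic_plane34 (span {x, y})"
    and xy: "\<langle>\<langle>x, x\<rangle>\<rangle> = \<langle>\<langle>y, y\<rangle>\<rangle>" "\<langle>\<langle>x, y\<rangle>\<rangle> = 0"
  shows "\<langle>\<langle>proj34 x, x\<rangle>\<rangle> = \<langle>\<langle>proj34 y, y\<rangle>\<rangle>" "\<langle>\<langle>proj34 x, y\<rangle>\<rangle> = 0"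
proof -
  obtain v w where vw: "span {x, y} = span {v, w}" "\<langle>\<langle>v, v\<rangle>\<rangle> = 1" "\<langle>\<langle>w, w\<rangle>\<rangle> = 1" "\<langle>\<langle>v, w\<rangle>\<rangle> = 0"
    "(\<lambda>\<theta>. \<langle>\<langle>proj34 (cos \<theta> *\<^sub>R v + sin \<theta> *\<^sub>R w), cos \<theta> *\<^sub>R v + sin \<theta> *\<^sub>R w\<rangle>\<rangle>) constant_on UNIV"
    using assms(1) unfolding isoclinic_plane34_def Let_def by blast
  have B: "bilinear (\<lambda>s t. \<langle>\<langle>proj34 s, t\<rangle>\<rangle>)"
    by (auto simp: bilinear_def ip22_def algebra_simps intro!: linearI)
  have sym: "\<langle>\<langle>proj34 s, t\<rangle>\<rangle> = \<langle>\<langle>proj34 t, s\<rangle>\<rangle>" for s t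
    by (simp add: ip22_def)
  have "x \<in> span {v, w}" "y \<in> span {v, w}"
    unfolding vw(1)[symmetric] by (auto intro: span_base)
  then show "\<langle>\<langle>proj34 x, x\<rangle>\<rangle> = \<langle>\<langle>proj34 y, y\<rangle>\<rangle>" "\<langle>\<langle>proj34 x, y\<rangle>\<rangle> = 0"
    using constant_on_circle_imp_conformal[OF B sym vw(5,2,3,4) _ _ _ xy] by auto
qed

lemma isoclinic_plane12_conformal:
  assumes "isoclinic_plane12 (span {x, y})"
    and xy: "\<langle>\<langle>x, x\<rangle>\<rangle> = \<langle>\<langle>y, y\<rangle>\<rangle>" "\<langle>\<langle>x, y\<rangle>\<rangle> = 0"
  shows "\<langle>\<langle>proj12 x, x\<rangle>\<rangle> = \<langle>\<langle>proj12 y, y\<rangle>\<rangle>" "\<langle>\<langle>proj12 x, y\<rangle>\<rangle> = 0"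
proof -
  obtain v w where vw: "span {x, y} = span {v, w}" "\<langle>\<langle>v, v\<rangle>\<rangle> = -1" "\<langle>\<langle>w, w\<rangle>\<rangle> = -1" "\<langle>\<langle>v, w\<rangle>\<rangle> = 0"
    "(\<lambda>\<theta>. \<langle>\<langle>proj12 (cos \<theta> *\<^sub>R v + sin \<theta> *\<^sub>R w), cos \<theta> *\<^sub>R v + sin \<theta> *\<^sub>R w\<rangle>\<rangle>) constant_on UNIV"
    using assms(1) unfolding isoclinic_plane12_def Let_def by blast
  have B: "bilinear (\<lambda>s t. \<langle>\<langle>proj12 s, t\<rangle>\<rangle>)"
    by (auto simp: bilinear_def ip22_def algebra_simps intro!: linearI)
  have sym: "\<langle>\<langle>proj12 s, t\<rangle>\<rangle> = \<langle>\<langle>proj12 t, s\<rangle>\<rangle>" for s t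
    by (simp add: ip22_def)
  have "x \<in> span {v, w}" "y \<in> span {v, w}"
    unfolding vw(1)[symmetric] by (auto intro: span_base)
  then show "\<langle>\<langle>proj12 x, x\<rangle>\<rangle> = \<langle>\<langle>proj12 y, y\<rangle>\<rangle>" "\<langle>\<langle>proj12 x, y\<rangle>\<rangle> = 0"
    using constant_on_circle_imp_conformal[OF B sym vw(5,2,3,4) _ _ _ xy] by auto
qed

text \<open>The metric is the sum of its restrictions to the two coordinate planes. The isoclinic condition
  makes \<open>(f\<^sub>u, f\<^sub>v)\<close> conformal for one summand, so by conformality of \<open>f\<close> it is conformal for the other
  summand as well; this is why the two kinds of isoclinic planes can be treated together.\<close>

lemma dv_eq_Lmap_du_if_isoclinic:
  assumes "isoclinic_plane34 (tangent_plane f w) \<or> isoclinic_plane12 (tangent_plane f w)"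
    and orient: "orientation_convention f w"
    and conf: "\<langle>\<langle>du f w, du f w\<rangle>\<rangle> = \<langle>\<langle>dv f w, dv f w\<rangle>\<rangle>" "\<langle>\<langle>du f w, dv f w\<rangle>\<rangle> = 0"
  shows "dv f w = Lmap (du f w)"
proof -
  define x y where "x = du f w" and "y = dv f w"
  have split: "\<langle>\<langle>s, t\<rangle>\<rangle> = \<langle>\<langle>proj12 s, t\<rangle>\<rangle> + \<langle>\<langle>proj34 s, t\<rangle>\<rangle>" for s t :: "real^4"
    by (simp add: ip22_def)
  have "\<langle>\<langle>proj34 x, x\<rangle>\<rangle> = \<langle>\<langle>proj34 y, y\<rangle>\<rangle> \<and> \<langle>\<langle>proj34 x, y\<rangle>\<rangle> = 0 \<and>
      \<langle>\<langle>proj12 x, x\<rangle>\<rangle> = \<langle>\<langle>proj12 y, y\<rangle>\<rangle> \<and> \<langle>\<langle>proj12 x, y\<rangle>\<rangle> = 0"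
    using assms(1)
  proof
    assume "isoclinic_plane34 (tangent_plane f w)"
    then show ?thesis
      using isoclinic_plane34_conformal[of x y] conf split[of x x] split[of y y] split[of x y]
      by (auto simp: tangent_plane_def x_def y_def)
  next
    assume "isoclinic_plane12 (tangent_plane f w)"
    then show ?thesis
      using isoclinic_plane12_conformal[of x y] conf split[of x x] split[of y y] split[of x y]
      by (auto simp: tangent_plane_def x_def y_def)
  qed
  then have "z12 y = \<i> * z12 x" "z34 y = \<i> * z34 x"
    using orientation_convention_det[OF orient, of z12] orientation_convention_det[OF orient, of z34]
    by (auto intro!: orthogonal_equal_length_complex simp: ip22_def z12_def z34_def x_def y_def)
  then show ?thesis
    by (simp add: complex_coordinates_eq_iff z12_Lmap z34_Lmap x_def y_def)
qed

section \<open>Holomorphic curves and their geometry\<close>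

definition hol_curve_on :: "(complex \<Rightarrow> real^4) \<Rightarrow> complex set \<Rightarrow> bool"
  where "hol_curve_on f M \<longleftrightarrow> (\<lambda>w. z12 (f w)) holomorphic_on M \<and> (\<lambda>w. z34 (f w)) holomorphic_on M"

definition of_z12_z34 :: "complex \<Rightarrow> complex \<Rightarrow> real^4"
  where "of_z12_z34 p q = vector [Re p, Im p, Re q, Im q]"

lemma of_z12_z34_nth [simp]:
  "of_z12_z34 p q $ 1 = Re p" "of_z12_z34 p q $ 2 = Im p"
  "of_z12_z34 p q $ 3 = Re q" "of_z12_z34 p q $ 4 = Im q"
  by (simp_all add: of_z12_z34_def vector_def)

lemma z12_of_z12_z34 [simp]: "z12 (of_z12_z34 p q) = p"
  and z34_of_z12_z34 [simp]: "z34 (of_z12_z34 p q) = q"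
  by (simp_all add: z12_def z34_def)

lemma of_z12_z34_collapse [simp]: "of_z12_z34 (z12 v) (z34 v) = v"
  by (simp add: complex_coordinates_eq_iff)

lemma has_derivative_of_z12_z34:
  assumes "(P has_field_derivative p) (at w)" "(Q has_field_derivative q) (at w)"
  shows "((\<lambda>w. of_z12_z34 (P w) (Q w)) has_derivative (\<lambda>h. of_z12_z34 (p * h) (q * h))) (at w)"
proof -
  have "linear (\<lambda>(p, q). of_z12_z34 p q)"
    by (auto intro!: linearI simp: vec4_eq_iff)
  then have "bounded_linear (\<lambda>(p, q). of_z12_z34 p q)"
    by (simp add: linear_conv_bounded_linear)
  from bounded_linear.has_derivative[OF this has_derivative_Pair[OF assms[unfolded has_field_derivative_def]]]
  show ?thesis
    by simp
qed

lemma du_dv_eqI: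
  assumes "(f has_derivative D) (at w)"
  shows "du f w = D 1" "dv f w = D \<i>"
  using frechet_derivative_at[OF assms] by (simp_all add: du_def dv_def)

lemma hol_curve_on_has_derivative:
  assumes "hol_curve_on f M" "open M" "w \<in> M"
  shows "(f has_derivative
    (\<lambda>h. of_z12_z34 (deriv (\<lambda>w. z12 (f w)) w * h) (deriv (\<lambda>w. z34 (f w)) w * h))) (at w)"
  using has_derivative_of_z12_z34[OF holomorphic_derivI holomorphic_derivI] assms
  unfolding hol_curve_on_def by fastforce

lemma
  assumes "hol_curve_on f M" "open M" "w \<in> M"
  shows z12_du: "z12 (du f w) = deriv (\<lambda>w. z12 (f w)) w"
    and z34_du: "z34 (du f w) = deriv (\<lambda>w. z34 (f w)) w"
    and dv_eq_Lmap_du: "dv f w = Lmap (du f w)"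
    and hol_curve_on_differentiable: "f differentiable (at w)"
  using du_dv_eqI[OF hol_curve_on_has_derivative[OF assms]] hol_curve_on_has_derivative[OF assms]
  by (auto simp: complex_coordinates_eq_iff z12_Lmap z34_Lmap mult.commute differentiable_def)

lemma hol_curve_on_cong:
  assumes "\<And>w. w \<in> M \<Longrightarrow> f w = g w"
  shows "hol_curve_on f M \<longleftrightarrow> hol_curve_on g M"
  unfolding hol_curve_on_def using assms by (auto cong: holomorphic_cong)

lemma hol_curve_on_du:
  assumes "hol_curve_on f M" "open M"
  shows "hol_curve_on (du f) M"
proof -
  have "(\<lambda>w. deriv (\<lambda>w. z12 (f w)) w) holomorphic_on M" "(\<lambda>w. deriv (\<lambda>w. z34 (f w)) w) holomorphic_on M"
    using assms by (auto simp: hol_curve_on_def intro: holomorphic_deriv)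
  then show ?thesis
    unfolding hol_curve_on_def using z12_du[OF assms] z34_du[OF assms] by (simp cong: holomorphic_cong)
qed

lemma hol_curve_on_Lmap:
  assumes "hol_curve_on f M"
  shows "hol_curve_on (\<lambda>w. Lmap (f w)) M"
  using assms by (auto simp: hol_curve_on_def z12_Lmap z34_Lmap intro!: holomorphic_intros)

lemma hol_curve_on_dv:
  assumes "hol_curve_on f M" "open M"
  shows "hol_curve_on (dv f) M"
  using hol_curve_on_Lmap[OF hol_curve_on_du[OF assms]] dv_eq_Lmap_du[OF assms]
  by (simp cong: hol_curve_on_cong)

lemma hol_curve_on_smooth:
  assumes "hol_curve_on f M" "open M"
  shows "smooth_on f M"
proof -
  have "Ck_on k f M" for k
    using assms(1)
  proof (induction k arbitrary: f)
    case 0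
    then show ?case
      using hol_curve_on_differentiable[OF 0 assms(2)]
      by (auto intro!: continuous_at_imp_continuous_on differentiable_imp_continuous_within)
  next
    case (Suc k)
    then show ?case
      using hol_curve_on_differentiable[OF Suc.prems assms(2)]
        hol_curve_on_du[OF Suc.prems assms(2)] hol_curve_on_dv[OF Suc.prems assms(2)] by simp
  qed
  then show ?thesis
    by (simp add: smooth_on_def)
qed

text \<open>Both complex coordinates \<open>h\<close> satisfy \<open>h\<^sub>v = \<i> h\<^sub>u\<close>, so differentiating twice in \<open>v\<close> produces
  the factor \<open>\<i>\<^sup>2\<close>.\<close>

lemma hol_curve_on_laplace:
  assumes f: "hol_curve_on f M" "open M" "w \<in> M"
  shows "dv (dv f) w = - du (du f) w"
proof -
  have eq: "z (dv (dv f) w) = - z (du (du f) w)"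
    if z: "z = z12 \<or> z = z34" for z
  proof -
    have L: "z (Lmap v) = \<i> * z v" for v
      using z by (auto simp: z12_Lmap z34_Lmap)
    have hol: "(\<lambda>w. z (du f w)) field_differentiable (at w)"
      using z hol_curve_on_du[OF f(1,2)] f(2,3)
      by (auto simp: hol_curve_on_def intro: holomorphic_on_imp_differentiable_at)
    have "\<forall>\<^sub>F w in nhds w. z (dv f w) = \<i> * z (du f w)"
      using eventually_nhds_in_open[OF f(2,3)]
      by eventually_elim (simp add: dv_eq_Lmap_du[OF f(1,2)] L)
    then have "deriv (\<lambda>w. z (dv f w)) w = \<i> * deriv (\<lambda>w. z (du f w)) w"
      using hol by (simp add: deriv_cong_ev)
    moreover have "z (du (dv f) w) = deriv (\<lambda>w. z (dv f w)) w"
      using z z12_du[OF hol_curve_on_dv[OF f(1,2)] f(2,3)] z34_du[OF hol_curve_on_dv[OF f(1,2)] f(2,3)] by auto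
    moreover have "z (du (du f) w) = deriv (\<lambda>w. z (du f w)) w"
      using z z12_du[OF hol_curve_on_du[OF f(1,2)] f(2,3)] z34_du[OF hol_curve_on_du[OF f(1,2)] f(2,3)] by auto
    ultimately show ?thesis
      by (simp add: dv_eq_Lmap_du[OF hol_curve_on_dv[OF f(1,2)] f(2,3)] L)
  qed
  have "z12 (- v) = - z12 v" "z34 (- v) = - z34 v" for v
    by (simp_all add: z12_def z34_def complex_eq_iff)
  then show ?thesis
    by (simp add: complex_coordinates_eq_iff eq)
qed

text \<open>For a conformal parametrization the mean curvature is a multiple of the normal part of the
  Laplacian.\<close>

lemma mean_curvature_conformal:
  assumes E: "\<langle>\<langle>du f w, du f w\<rangle>\<rangle> = \<langle>\<langle>dv f w, dv f w\<rangle>\<rangle>" "\<langle>\<langle>du f w, dv f w\<rangle>\<rangle> = 0" "\<langle>\<langle>du f w, du f w\<rangle>\<rangle> \<noteq> 0"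
    and laplace: "dv (dv f) w = - du (du f) w"
  shows "mean_curvature f w = 0"
proof -
  interpret conformal_frame "du f w" "dv f w"
    using E by unfold_locales auto
  have "normal_part f w (- z) = - normal_part f w z" for z
    unfolding normal_part_def tangent_plane_def normal_component_eq
    by (simp add: bilinear_lneg[OF bilinear_ip22])
  then show ?thesis
    using E by (simp add: mean_curvature_def Let_def laplace)
qed

lemma frechet_derivative_expand:
  assumes "f differentiable (at w)"
  shows "frechet_derivative f (at w) h = Re h *\<^sub>R du f w + Im h *\<^sub>R dv f w"
proof -
  interpret linear "frechet_derivative f (at w)"
    using assms by (rule linear_frechet_derivative)
  have "h = Re h *\<^sub>R 1 + Im h *\<^sub>R \<i>"
    by (simp add: complex_eq_iff)
  then have "frechet_derivative f (at w) h = frechet_derivative f (at w) (Re h *\<^sub>R 1 + Im h *\<^sub>R \<i>)"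
    by simp
  also have "\<dots> = Re h *\<^sub>R du f w + Im h *\<^sub>R dv f w"
    by (simp only: add scale du_def dv_def)
  finally show ?thesis .
qed

text \<open>The equation \<open>f\<^sub>v = L f\<^sub>u\<close> says that the real derivative of each complex coordinate commutes with
  multiplication by \<open>\<i>\<close>.\<close>

lemma hol_curve_on_if_cauchy_riemann:
  assumes "open M"
    and diff: "\<And>w. w \<in> M \<Longrightarrow> f differentiable (at w)"
    and CR: "\<And>w. w \<in> M \<Longrightarrow> dv f w = Lmap (du f w)"
  shows "hol_curve_on f M"
proof -
  have "(\<lambda>w. z (f w)) holomorphic_on M" if z: "bounded_linear z" "\<And>v. z (Lmap v) = \<i> * z v" for z
    unfolding holomorphic_on_open[OF assms(1)]
  proof
    fix w assume w: "w \<in> M"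
    have "frechet_derivative f (at w) = (\<lambda>h. Re h *\<^sub>R du f w + Im h *\<^sub>R dv f w)"
      using frechet_derivative_expand[OF diff[OF w]] by blast
    then have "(f has_derivative (\<lambda>h. Re h *\<^sub>R du f w + Im h *\<^sub>R dv f w)) (at w)"
      using diff[OF w] by (simp add: frechet_derivative_works)
    then have "((\<lambda>w. z (f w)) has_derivative (\<lambda>h. z (Re h *\<^sub>R du f w + Im h *\<^sub>R dv f w))) (at w)"
      by (rule bounded_linear.has_derivative[OF z(1)])
    moreover have "z (Re h *\<^sub>R du f w + Im h *\<^sub>R dv f w) = z (du f w) * h" for h
    proof -
      have "z (Re h *\<^sub>R du f w + Im h *\<^sub>R dv f w) = Re h *\<^sub>R z (du f w) + Im h *\<^sub>R (\<i> * z (du f w))"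
        using bounded_linear.linear[OF z(1)] by (simp add: linear_add linear_scale CR[OF w] z(2))
      also have "\<dots> = z (du f w) * h"
        by (simp add: complex_eq_iff algebra_simps)
      finally show ?thesis .
    qed
    ultimately show "\<exists>f'. ((\<lambda>w. z (f w)) has_field_derivative f') (at w)"
      unfolding has_field_derivative_def by auto
  qed
  then show ?thesis
    by (simp add: hol_curve_on_def bounded_linear_z12 bounded_linear_z34 z12_Lmap z34_Lmap)
qed

lemma hol_curve_on_conformal_immersion:
  assumes f: "hol_curve_on f M" "open M"
    and nondeg: "\<And>w. w \<in> M \<Longrightarrow> \<langle>\<langle>du f w, du f w\<rangle>\<rangle> \<noteq> 0"
  shows "conformal_immersion_on f M"
proof -
  have "inj (frechet_derivative f (at w))" if w: "w \<in> M" for w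
  proof -
    note diff = hol_curve_on_differentiable[OF f w]
    interpret conformal_frame "du f w" "dv f w"
      using nondeg[OF w] by unfold_locales (auto simp: dv_eq_Lmap_du[OF f w])
    show ?thesis
      unfolding linear_injective_0[OF linear_frechet_derivative[OF diff]]
      using combination_eq_0 by (auto simp: frechet_derivative_expand[OF diff] complex_eq_iff)
  qed
  then show ?thesis
    using hol_curve_on_smooth[OF f] nondeg dv_eq_Lmap_du[OF f]
    by (auto simp: conformal_immersion_on_def immersion_on_def)
qed

lemma hol_curve_on_mean_curvature:
  assumes f: "hol_curve_on f M" "open M" "w \<in> M"
    and nondeg: "\<langle>\<langle>du f w, du f w\<rangle>\<rangle> \<noteq> 0"
  shows "mean_curvature f w = 0"
  using assms by (intro mean_curvature_conformal hol_curve_on_laplace) (auto simp: dv_eq_Lmap_du)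

lemma dw_nth:
  assumes "dv f w = Lmap (du f w)"
  shows "dw f w $ 1 = z12 (du f w) / 2" "dw f w $ 2 = - \<i> * z12 (du f w) / 2"
    "dw f w $ 3 = z34 (du f w) / 2" "dw f w $ 4 = - \<i> * z34 (du f w) / 2"
  by (simp_all add: dw_def assms cplx_vec_def z12_def z34_def complex_eq_iff)

text \<open>The coordinates of \<open>f\<^sub>w\<close> come in pairs \<open>(a, -\<i> a)\<close>, whose squares cancel and whose squared moduli
  add up.\<close>

lemma dw_null:
  assumes "dv f w = Lmap (du f w)"
  shows "\<langle>\<langle>dw f w, dw f w\<rangle>\<rangle> = 0"
    and "\<langle>\<langle>dw f w, cnj_vec (dw f w)\<rangle>\<rangle> = of_real (\<langle>\<langle>du f w, du f w\<rangle>\<rangle> / 2)"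
proof -
  show "\<langle>\<langle>dw f w, dw f w\<rangle>\<rangle> = 0"
    by (simp add: ip22_def dw_nth[OF assms] algebra_simps)
  show "\<langle>\<langle>dw f w, cnj_vec (dw f w)\<rangle>\<rangle> = of_real (\<langle>\<langle>du f w, du f w\<rangle>\<rangle> / 2)"
    unfolding ip22_self of_real_divide of_real_diff complex_norm_square
    by (simp add: ip22_def cnj_vec_def dw_nth[OF assms] field_simps)
qed

lemma hol_curve_on_bjorling_pos:
  assumes f: "hol_curve_on f M" "open M"
    and pos: "\<And>w. w \<in> M \<Longrightarrow> \<langle>\<langle>du f w, du f w\<rangle>\<rangle> > 0"
    and "\<And>t. t \<in> I \<Longrightarrow> f (of_real t) = c t"
  shows "bjorling_pos c I f M"
proof -
  have nondeg: "\<langle>\<langle>du f w, du f w\<rangle>\<rangle> \<noteq> 0" if "w \<in> M" for w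
    using pos[OF that] by simp
  have "cp_point (dw f w) \<in> Q_pos" if w: "w \<in> M" for w
  proof -
    have "\<langle>\<langle>dw f w, cnj_vec (dw f w)\<rangle>\<rangle> \<noteq> 0"
      unfolding dw_null(2)[OF dv_eq_Lmap_du[OF f w]] using nondeg[OF w] by simp
    then have "dw f w \<noteq> 0"
      by auto
    moreover have "Re \<langle>\<langle>dw f w, cnj_vec (dw f w)\<rangle>\<rangle> > 0"
      unfolding dw_null(2)[OF dv_eq_Lmap_du[OF f w]] using pos[OF w] by simp
    ultimately show ?thesis
      using dw_null(1)[OF dv_eq_Lmap_du[OF f w]] unfolding Q_pos_def by blast
  qed
  moreover have "isoclinic_on34 f M"
    using isoclinic_plane34_Lmap[OF pos] dv_eq_Lmap_du[OF f]
    by (auto simp: isoclinic_on34_def tangent_plane_def orientation_convention_Lmap)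
  ultimately show ?thesis
    using assms(4) hol_curve_on_conformal_immersion[OF f nondeg] hol_curve_on_mean_curvature[OF f _ nondeg]
    by (simp add: bjorling_pos_def)
qed

lemma hol_curve_on_bjorling_neg:
  assumes f: "hol_curve_on f M" "open M"
    and neg: "\<And>w. w \<in> M \<Longrightarrow> \<langle>\<langle>du f w, du f w\<rangle>\<rangle> < 0"
    and "\<And>t. t \<in> I \<Longrightarrow> f (of_real t) = c t"
  shows "bjorling_neg c I f M"
proof -
  have nondeg: "\<langle>\<langle>du f w, du f w\<rangle>\<rangle> \<noteq> 0" if "w \<in> M" for w
    using neg[OF that] by simp
  have "cp_point (dw f w) \<in> Q_neg" if w: "w \<in> M" for w
  proof -
    have "\<langle>\<langle>dw f w, cnj_vec (dw f w)\<rangle>\<rangle> \<noteq> 0"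
      unfolding dw_null(2)[OF dv_eq_Lmap_du[OF f w]] using nondeg[OF w] by simp
    then have "dw f w \<noteq> 0"
      by auto
    moreover have "Re \<langle>\<langle>dw f w, cnj_vec (dw f w)\<rangle>\<rangle> < 0"
      unfolding dw_null(2)[OF dv_eq_Lmap_du[OF f w]] using neg[OF w] by simp
    ultimately show ?thesis
      using dw_null(1)[OF dv_eq_Lmap_du[OF f w]] unfolding Q_neg_def by blast
  qed
  moreover have "isoclinic_on12 f M"
    using isoclinic_plane12_Lmap[OF neg] dv_eq_Lmap_du[OF f]
    by (auto simp: isoclinic_on12_def tangent_plane_def orientation_convention_Lmap)
  ultimately show ?thesis
    using assms(4) hol_curve_on_conformal_immersion[OF f nondeg] hol_curve_on_mean_curvature[OF f _ nondeg]
    by (simp add: bjorling_neg_def)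
qed

text \<open>The half of the uniqueness proof that concerns a single surface: the geometric conditions force
  the Cauchy-Riemann equations.\<close>

lemma isoclinic_imp_hol_curve_on:
  assumes "open M" and conf: "conformal_immersion_on f M"
    and iso: "isoclinic_on34 f M \<or> isoclinic_on12 f M"
  shows "hol_curve_on f M"
proof (rule hol_curve_on_if_cauchy_riemann[OF \<open>open M\<close>])
  fix w assume w: "w \<in> M"
  have "Ck_on (Suc 0) f M"
    using conf by (simp only: conformal_immersion_on_def immersion_on_def smooth_on_def)
  then show "f differentiable (at w)"
    using w by simp
  show "dv f w = Lmap (du f w)"
    using w iso conf by (intro dv_eq_Lmap_du_if_isoclinic)
      (auto simp: isoclinic_on34_def isoclinic_on12_def conformal_immersion_on_def)
qed

section \<open>Complexification of real analytic curves\<close>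

lemma holomorphic_eq_from_reals:
  assumes S: "open S" "connected S" and hol: "f holomorphic_on S" "g holomorphic_on S"
    and T: "open T" "x \<in> T" "complex_of_real ` T \<subseteq> S"
    and eq: "\<And>t. t \<in> T \<Longrightarrow> f (of_real t) = g (of_real t)"
    and w: "w \<in> S"
  shows "f w = g w"
proof -
  have "x islimpt T"
    using T by (intro interior_limit_point) (simp add: interior_open)
  then have lim: "complex_of_real x islimpt complex_of_real ` T"
    unfolding islimpt_approachable by (metis dist_of_real image_eqI of_real_eq_iff)
  have "f w - g w = 0"
    by (rule analytic_continuation[OF _ S T(3) _ lim _ w, of "\<lambda>w. f w - g w"])
      (use T hol eq in \<open>auto intro!: holomorphic_intros\<close>)
  then show ?thesis
    by simp
qed

lemma hol_curve_on_eq_from_reals: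
  assumes M: "open M" "connected M" and curves: "hol_curve_on f M" "hol_curve_on g M"
    and I: "open I" "x \<in> I" "complex_of_real ` I \<subseteq> M"
    and eq: "\<And>t. t \<in> I \<Longrightarrow> f (of_real t) = g (of_real t)"
    and w: "w \<in> M"
  shows "f w = g w"
  using curves eq unfolding hol_curve_on_def complex_coordinates_eq_iff
  by (auto intro: holomorphic_eq_from_reals[OF M _ _ I _ w])

text \<open>Convergence at the real point \<open>t + \<rho>\<close> already gives convergence on the whole complex disc of
  radius \<open>\<rho>\<close>.\<close>

lemma complexified_power_series:
  assumes "\<rho> > 0"
    and sums: "\<And>s. \<bar>s - t\<bar> \<le> \<rho> \<Longrightarrow> (\<lambda>n. (s - t) ^ n * a n) sums c s"
  obtains F where "F holomorphic_on ball (complex_of_real t) \<rho>"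
    and "\<And>s. \<bar>s - t\<bar> < \<rho> \<Longrightarrow> F (complex_of_real s) = of_real (c s)"
proof
  define F where "F w = (\<Sum>n. complex_of_real (a n) * (w - of_real t) ^ n)" for w
  have "summable (\<lambda>n. \<rho> ^ n * a n)"
    using sums[of "t + \<rho>"] \<open>\<rho> > 0\<close> by (auto simp: sums_iff)
  then have "summable (\<lambda>n. complex_of_real (\<rho> ^ n * a n))"
    by (rule summable_of_real)
  then have at_\<rho>: "summable (\<lambda>n. complex_of_real (a n) * of_real \<rho> ^ n)"
    by (simp add: mult.commute)
  have F: "(\<lambda>n. complex_of_real (a n) * (w - of_real t) ^ n) sums F w"
    if "w \<in> ball (complex_of_real t) \<rho>" for w
    unfolding F_def
    by (rule summable_sums, rule powser_inside[OF at_\<rho>])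
      (use that \<open>\<rho> > 0\<close> in \<open>simp add: dist_norm norm_minus_commute\<close>)
  then show "F holomorphic_on ball (complex_of_real t) \<rho>"
    by (rule power_series_holomorphic)
  fix s assume s: "\<bar>s - t\<bar> < \<rho>"
  have "(\<lambda>n. complex_of_real ((s - t) ^ n * a n)) sums of_real (c s)"
    using sums[of s] s by (simp only: sums_of_real_iff)
  moreover have "(\<lambda>n. complex_of_real ((s - t) ^ n * a n)) sums F (of_real s)"
    using F[of "of_real s"] s by (simp add: dist_real_def abs_minus_commute mult.commute)
  ultimately show "F (complex_of_real s) = of_real (c s)"
    by (rule sums_unique2[symmetric])
qed

lemma real_analytic_local_extension:
  assumes c: "real_analytic_on c I" and I: "open I" "t \<in> I"
  obtains \<rho> F where "\<rho> > 0" "ball t \<rho> \<subseteq> I"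
    "\<And>j. (\<lambda>w. F w $ j) holomorphic_on ball (complex_of_real t) \<rho>"
    "\<And>s. s \<in> ball t \<rho> \<Longrightarrow> F (of_real s) = cplx_vec (c s)"
proof -
  obtain a e where e: "e > 0"
    and sums: "\<And>s. s \<in> I \<Longrightarrow> \<bar>s - t\<bar> < e \<Longrightarrow> (\<lambda>n. (s - t) ^ n *\<^sub>R a n) sums c s"
    using c I(2) unfolding real_analytic_on_def by blast
  obtain d where d: "d > 0" "cball t d \<subseteq> I"
    using I open_contains_cball by blast
  \<comment> \<open>Half of \<open>e\<close>, so that the series still converges at distance exactly \<open>\<rho>\<close>.\<close>
  define \<rho> where "\<rho> = min d (e / 2)"
  have \<rho>: "\<rho> > 0" "\<rho> < e" "cball t \<rho> \<subseteq> I"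
    using d e by (auto simp: \<rho>_def)
  have "\<exists>F. F holomorphic_on ball (complex_of_real t) \<rho> \<and>
      (\<forall>s. \<bar>s - t\<bar> < \<rho> \<longrightarrow> F (complex_of_real s) = of_real (c s $ j))" for j
  proof -
    have "(\<lambda>n. (s - t) ^ n * a n $ j) sums (c s $ j)" if "\<bar>s - t\<bar> \<le> \<rho>" for s
    proof -
      have "s \<in> I" "\<bar>s - t\<bar> < e"
        using that \<rho> by (auto simp: dist_real_def abs_minus_commute subset_iff)
      from bounded_linear.sums[OF bounded_linear_vec_nth sums[OF this], of j] show ?thesis
        by simp
    qed
    from complexified_power_series[OF \<rho>(1) this] show ?thesis
      by metis
  qed
  then obtain F where F: "\<And>j. F j holomorphic_on ball (complex_of_real t) \<rho>"
    "\<And>j s. \<bar>s - t\<bar> < \<rho> \<Longrightarrow> F j (complex_of_real s) = of_real (c s $ j)"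
    by metis
  show ?thesis
  proof (rule that[of \<rho> "\<lambda>w. \<chi> j. F j w"])
    show "ball t \<rho> \<subseteq> I"
      using \<rho>(3) ball_subset_cball by blast
  qed (use \<rho> F in \<open>auto simp: cplx_vec_def dist_real_def abs_minus_commute\<close>)
qed

lemma Re_in_ball_of_real:
  assumes "w \<in> ball (complex_of_real t) \<rho>"
  shows "Re w \<in> ball t \<rho>"
  using assms abs_Re_le_cmod[of "of_real t - w"] by (simp add: dist_norm)

text \<open>The local extensions live on discs centred on \<open>I\<close>. Two such discs that meet have a convex
  intersection that contains the real part of each of its points, so the extensions agree there by
  the identity theorem, and choosing any disc around \<open>w\<close> gives a well-defined extension.\<close>

lemma real_analytic_extension:
  assumes c: "real_analytic_on c I" and I: "open I"
  obtains U C where "open U" "complex_of_real ` I \<subseteq> U" "holomorphic_extension c I C U"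
proof -
  have "\<exists>\<rho> F. \<rho> > 0 \<and> ball t \<rho> \<subseteq> I \<and>
      (\<forall>j. (\<lambda>w. F w $ j) holomorphic_on ball (complex_of_real t) \<rho>) \<and>
      (\<forall>s\<in>ball t \<rho>. F (of_real s) = cplx_vec (c s))" if "t \<in> I" for t
    using real_analytic_local_extension[OF c I that] by metis
  then obtain \<rho> F where \<rho>: "\<And>t. t \<in> I \<Longrightarrow> \<rho> t > 0" "\<And>t. t \<in> I \<Longrightarrow> ball t (\<rho> t) \<subseteq> I"
    and hol: "\<And>t j. t \<in> I \<Longrightarrow> (\<lambda>w. F t w $ j) holomorphic_on ball (complex_of_real t) (\<rho> t)"
    and F: "\<And>t s. t \<in> I \<Longrightarrow> s \<in> ball t (\<rho> t) \<Longrightarrow> F t (of_real s) = cplx_vec (c s)"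
    by metis
  define B where "B t = ball (complex_of_real t) (\<rho> t)" for t
  have overlap: "F s w = F t w" if st: "s \<in> I" "t \<in> I" and w: "w \<in> B s" "w \<in> B t" for s t w
  proof -
    have "F s w $ j = F t w $ j" for j
    proof (rule holomorphic_eq_from_reals[where S = "B s \<inter> B t" and T = "ball s (\<rho> s) \<inter> ball t (\<rho> t)"
          and f = "\<lambda>w. F s w $ j" and g = "\<lambda>w. F t w $ j"])
      show "connected (B s \<inter> B t)"
        by (simp add: B_def convex_Int convex_connected)
      show "Re w \<in> ball s (\<rho> s) \<inter> ball t (\<rho> t)"
        using w Re_in_ball_of_real unfolding B_def by blast
      show "(\<lambda>w. F s w $ j) holomorphic_on B s \<inter> B t" "(\<lambda>w. F t w $ j) holomorphic_on B s \<inter> B t"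
        using hol st unfolding B_def by (meson holomorphic_on_subset inf_le1 inf_le2)+
    qed (use st w F in \<open>auto simp: B_def\<close>)
    then show ?thesis
      by (simp add: vec_eq_iff)
  qed
  define C where "C w = F (SOME t. t \<in> I \<and> w \<in> B t) w" for w
  have C: "C w = F t w" if "t \<in> I" "w \<in> B t" for t w
    unfolding C_def by (rule someI2[of _ t]) (use that overlap in blast)+
  show ?thesis
  proof (rule that)
    show "open (\<Union>t\<in>I. B t)"
      by (auto simp: B_def)
    show "complex_of_real ` I \<subseteq> (\<Union>t\<in>I. B t)"
      using \<rho>(1) by (force simp: B_def)
    have "(\<lambda>w. C w $ j) holomorphic_on (\<Union>t\<in>I. B t)" for j
    proof (rule holomorphic_on_UN_open)
      show "(\<lambda>w. C w $ j) holomorphic_on B t" if "t \<in> I" for t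
        using hol[OF that, of j, folded B_def] C[OF that] by (simp cong: holomorphic_cong)
    qed (auto simp: B_def)
    moreover have "C (of_real t) = cplx_vec (c t)" if "t \<in> I" for t
      using C[of t "of_real t"] F[of t t] \<rho>(1) that by (simp add: B_def)
    ultimately show "holomorphic_extension c I C (\<Union>t\<in>I. B t)"
      by (simp add: holomorphic_extension_def)
  qed
qed

section \<open>Simply connected domains around an interval\<close>

text \<open>A union of discs centred on \<open>I\<close> contains with each point the vertical segment down to the real
  axis. So it deforms first vertically onto \<open>I\<close> and then, \<open>I\<close> being convex, along \<open>I\<close> to a point.\<close>

lemma simply_connected_neighbourhood:
  fixes I :: "real set"
  assumes U: "open U" "complex_of_real ` I \<subseteq> U" and I: "open I" "convex I" "I \<noteq> {}"
  obtains M where "open M" "connected M" "simply_connected M" "complex_of_real ` I \<subseteq> M" "M \<subseteq> U"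
proof -
  \<comment> \<open>The condition on real balls ensures that the real part of every point of \<open>M\<close> lies in \<open>I\<close>.\<close>
  define \<B> where "\<B> = {(t, \<rho>). ball (complex_of_real t) \<rho> \<subseteq> U \<and> ball t \<rho> \<subseteq> I}"
  define M where "M = (\<Union>(t, \<rho>)\<in>\<B>. ball (complex_of_real t) \<rho>)"
  obtain t0 where t0: "t0 \<in> I"
    using I by blast
  have I_M: "complex_of_real ` I \<subseteq> M"
  proof
    fix w assume "w \<in> complex_of_real ` I"
    then obtain t where t: "t \<in> I" "w = of_real t"
      by blast
    obtain \<rho>1 where "\<rho>1 > 0" "ball (complex_of_real t) \<rho>1 \<subseteq> U"
      using U t open_contains_ball by blast
    moreover obtain \<rho>2 where "\<rho>2 > 0" "ball t \<rho>2 \<subseteq> I"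
      using I t open_contains_ball by blast
    ultimately have "(t, min \<rho>1 \<rho>2) \<in> \<B>" "w \<in> ball (complex_of_real t) (min \<rho>1 \<rho>2)"
      unfolding \<B>_def t by (auto simp: subset_iff)
    then show "w \<in> M"
      unfolding M_def by blast
  qed
  have "homotopic_with_canon (\<lambda>_. True) M M id (\<lambda>w. of_real (Re w))"
  proof (rule homotopic_with_linear)
    fix w assume "w \<in> M"
    then obtain t \<rho> where t\<rho>: "(t, \<rho>) \<in> \<B>" "w \<in> ball (complex_of_real t) \<rho>"
      by (auto simp: M_def)
    moreover have "complex_of_real (Re w) \<in> ball (complex_of_real t) \<rho>"
      using Re_in_ball_of_real[OF t\<rho>(2)] by simp
    ultimately have "closed_segment w (of_real (Re w)) \<subseteq> ball (complex_of_real t) \<rho>"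
      by (intro closed_segment_subset convex_ball)
    then show "closed_segment (id w) (complex_of_real (Re w)) \<subseteq> M"
      using t\<rho>(1) by (auto simp: M_def)
  qed (auto intro!: continuous_intros)
  moreover have "homotopic_with_canon (\<lambda>_. True) M M (\<lambda>w. of_real (Re w)) (\<lambda>w. of_real t0)"
  proof (rule homotopic_with_linear)
    fix w assume "w \<in> M"
    then have "Re w \<in> I"
      using Re_in_ball_of_real by (fastforce simp: M_def \<B>_def)
    then have "closed_segment (Re w) t0 \<subseteq> I"
      using t0 I(2) by (rule closed_segment_subset)
    then show "closed_segment (complex_of_real (Re w)) (of_real t0) \<subseteq> M"
      using I_M unfolding closed_segment_of_real by blast
  qed (auto intro!: continuous_intros)
  ultimately have "homotopic_with_canon (\<lambda>_. True) M M id (\<lambda>w. of_real t0)"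
    by (rule homotopic_with_trans)
  then have "contractible M"
    unfolding contractible_def by blast
  moreover have "open M" "M \<subseteq> U"
    by (auto simp: M_def \<B>_def)
  ultimately show ?thesis
    using that I_M contractible_imp_simply_connected contractible_imp_path_connected
      path_connected_imp_connected by blast
qed

section \<open>The Bjorling integral\<close>

text \<open>A primitive gives the value on every path. The domain has to be connected so that there is a path
  at all, without which any vector would satisfy the defining condition of the integral.\<close>

lemma integral_within_eq:
  assumes M: "open M" "connected M" "a \<in> M" "b \<in> M"
    and G: "\<And>j w. w \<in> M \<Longrightarrow> ((\<lambda>w. G w $ j) has_field_derivative F w $ j) (at w)"
  shows "integral_within M a b F = G b - G a"
  unfolding integral_within_def
proof (rule the_equality)
  have "((\<lambda>\<xi>. F \<xi> $ j) has_contour_integral ((G b - G a) $ j)) \<gamma>"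
    if "valid_path \<gamma>" "path_image \<gamma> \<subseteq> M" "pathstart \<gamma> = a" "pathfinish \<gamma> = b" for \<gamma> j
    using contour_integral_primitive[of M "\<lambda>w. G w $ j" "\<lambda>w. F w $ j" \<gamma>] G that
    by (simp add: has_field_derivative_at_within)
  then show prim: "\<forall>\<gamma>. valid_path \<gamma> \<and> path_image \<gamma> \<subseteq> M \<and> pathstart \<gamma> = a \<and> pathfinish \<gamma> = b \<longrightarrow>
      (\<forall>j. ((\<lambda>\<xi>. F \<xi> $ j) has_contour_integral ((G b - G a) $ j)) \<gamma>)"
    by blast
  obtain \<gamma> where \<gamma>: "valid_path \<gamma>" "path_image \<gamma> \<subseteq> M" "pathstart \<gamma> = a" "pathfinish \<gamma> = b"
    using connected_open_polynomial_connected[OF M] valid_path_polynomial_function by blast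
  fix y assume "\<forall>\<gamma>. valid_path \<gamma> \<and> path_image \<gamma> \<subseteq> M \<and> pathstart \<gamma> = a \<and> pathfinish \<gamma> = b \<longrightarrow>
      (\<forall>j. ((\<lambda>\<xi>. F \<xi> $ j) has_contour_integral (y $ j)) \<gamma>)"
  then show "y = G b - G a"
    using prim \<gamma> has_contour_integral_unique unfolding vec_eq_iff by blast
qed

text \<open>With \<open>C - \<i> L C\<close> as primitive, the first two components of \<open>f\<close> are \<open>Re (C\<^sup>1 + \<i> C\<^sup>2)\<close> and
  \<open>Re (C\<^sup>2 - \<i> C\<^sup>1) = Im (C\<^sup>1 + \<i> C\<^sup>2)\<close>, and similarly for the last two. The constants match because
  \<open>C 0 = c 0\<close> is real.\<close>

lemma bjorling_map_coordinates:
  assumes M: "open M" "connected M" "complex_of_real ` I \<subseteq> M" "0 \<in> I"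
    and C: "holomorphic_extension c I C M" and w: "w \<in> M"
  shows "z12 (bjorling_map M c C w) = C w $ 1 + \<i> * C w $ 2"
    and "z34 (bjorling_map M c C w) = C w $ 3 + \<i> * C w $ 4"
proof -
  have M0: "0 \<in> M"
    using M(3,4) by force
  have C0: "C 0 = cplx_vec (c 0)"
    using C M(4) unfolding holomorphic_extension_def by force
  have C': "((\<lambda>\<xi>. C \<xi> $ j) has_field_derivative deriv_vec C \<xi> $ j) (at \<xi>)" if "\<xi> \<in> M" for \<xi> j
    using C that M(1) by (auto simp: holomorphic_extension_def deriv_vec_def intro: holomorphic_derivI)
  have "\<forall>j. ((\<lambda>\<xi>. (C \<xi> - \<i> *s Lmap (C \<xi>)) $ j) has_field_derivative
      (deriv_vec C \<xi> - \<i> *s Lmap (deriv_vec C \<xi>)) $ j) (at \<xi>)" if "\<xi> \<in> M" for \<xi>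
    unfolding forall_4 using C'[OF that] by (auto intro!: derivative_eq_intros)
  then have "integral_within M 0 w (\<lambda>\<xi>. deriv_vec C \<xi> - \<i> *s Lmap (deriv_vec C \<xi>)) =
      (C w - \<i> *s Lmap (C w)) - (C 0 - \<i> *s Lmap (C 0))"
    by (intro integral_within_eq[OF M(1,2) M0 w]) blast
  then have "bjorling_map M c C w = of_z12_z34 (C w $ 1 + \<i> * C w $ 2) (C w $ 3 + \<i> * C w $ 4)"
    by (simp add: bjorling_map_def vec4_eq_iff Re_vec_def C0 cplx_vec_def)
  then show "z12 (bjorling_map M c C w) = C w $ 1 + \<i> * C w $ 2"
    and "z34 (bjorling_map M c C w) = C w $ 3 + \<i> * C w $ 4"
    by simp_all
qed

section \<open>Existence and uniqueness\<close>

text \<open>The Bjorling map in closed form. It makes sense without any path integral, hence on the whole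
  domain of \<open>C\<close>, which serves to locate the region where the metric has the prescribed sign before
  the simply connected domain is chosen.\<close>

definition complexified_curve :: "(complex \<Rightarrow> complex^4) \<Rightarrow> complex \<Rightarrow> real^4"
  where "complexified_curve C w = of_z12_z34 (C w $ 1 + \<i> * C w $ 2) (C w $ 3 + \<i> * C w $ 4)"

lemma hol_curve_on_complexified_curve:
  assumes "holomorphic_extension c I C U"
  shows "hol_curve_on (complexified_curve C) U"
  using assms by (auto simp: hol_curve_on_def complexified_curve_def holomorphic_extension_def
      intro!: holomorphic_intros)

lemma complexified_curve_of_real:
  assumes "holomorphic_extension c I C U" "t \<in> I"
  shows "complexified_curve C (of_real t) = c t"
  using assms by (simp add: complexified_curve_def holomorphic_extension_def vec4_eq_iff cplx_vec_def)

text \<open>On the real axis the velocity \<open>f\<^sub>u\<close> is that of \<open>c\<close>, so the metric of \<open>f\<close> has there the sign that is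
  known for \<open>c\<close>.\<close>

lemma du_eq_vector_derivative:
  assumes I: "open I" "t \<in> I" and f: "f differentiable (at (complex_of_real t))"
    and fc: "\<And>s. s \<in> I \<Longrightarrow> f (of_real s) = c s"
  shows "du f (of_real t) = vector_derivative c (at t)"
proof -
  have "((\<lambda>s. f (complex_of_real s)) has_derivative (\<lambda>h. frechet_derivative f (at (of_real t)) (of_real h))) (at t)"
    using f by (intro has_derivative_compose[OF has_derivative_of_real[OF has_derivative_ident]])
      (simp add: frechet_derivative_works)
  then have "((\<lambda>s. f (complex_of_real s)) has_vector_derivative du f (of_real t)) (at t)"
    by (simp add: has_vector_derivative_def frechet_derivative_expand[OF f])
  then have "(c has_vector_derivative du f (of_real t)) (at t)"
    using I fc by (rule has_vector_derivative_transform_within_open)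
  then show ?thesis
    by (simp add: vector_derivative_at)
qed

lemma hol_curve_on_continuous_speed:
  assumes "hol_curve_on f M" "open M"
  shows "continuous_on M (\<lambda>w. \<langle>\<langle>du f w, du f w\<rangle>\<rangle>)"
  using hol_curve_on_du[OF assms] unfolding ip22_self hol_curve_on_def
  by (intro continuous_intros holomorphic_on_imp_continuous_on) auto

text \<open>The positive and the negative case share this proof. The open set \<open>A\<close> of admissible values of
  \<open>\<langle>f\<^sub>u, f\<^sub>u\<rangle>\<close> will be a half-line, and \<open>P\<close> stands for the conditions of the Bjorling problem, which enter only
  through their relation to holomorphic curves.\<close>

lemma bjorling_problem_solution:
  fixes P :: "(complex \<Rightarrow> real^4) \<Rightarrow> complex set \<Rightarrow> bool"
  assumes c: "real_analytic_on c I" and I: "open I" "convex I" "0 \<in> I"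
    and A: "open A" "\<And>t. t \<in> I \<Longrightarrow> \<langle>\<langle>vector_derivative c (at t), vector_derivative c (at t)\<rangle>\<rangle> \<in> A"
    and P_I: "\<And>f M. hol_curve_on f M \<Longrightarrow> open M \<Longrightarrow> (\<And>w. w \<in> M \<Longrightarrow> \<langle>\<langle>du f w, du f w\<rangle>\<rangle> \<in> A) \<Longrightarrow>
      (\<And>t. t \<in> I \<Longrightarrow> f (of_real t) = c t) \<Longrightarrow> P f M"
    and P_D: "\<And>g M. P g M \<Longrightarrow> open M \<Longrightarrow> hol_curve_on g M"
      "\<And>g M t. P g M \<Longrightarrow> t \<in> I \<Longrightarrow> g (of_real t) = c t"
  shows "\<exists>M C. open M \<and> connected M \<and> simply_connected M \<and> complex_of_real ` I \<subseteq> M \<and>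
    holomorphic_extension c I C M \<and>
    (\<forall>D. holomorphic_extension c I D M \<longrightarrow> (\<forall>w\<in>M. D w = C w)) \<and>
    P (bjorling_map M c C) M \<and>
    (\<forall>g. P g M \<longrightarrow> (\<forall>w\<in>M. g w = bjorling_map M c C w))"
proof -
  obtain U C where U: "open U" "complex_of_real ` I \<subseteq> U" and C: "holomorphic_extension c I C U"
    using real_analytic_extension[OF c I(1)] by metis
  define X where "X = complexified_curve C"
  have X: "hol_curve_on X U"
    using hol_curve_on_complexified_curve[OF C] by (simp add: X_def)
  \<comment> \<open>Openness of \<open>A\<close> keeps the metric of the right sign near \<open>I\<close>.\<close>
  define V where "V = U \<inter> (\<lambda>w. \<langle>\<langle>du X w, du X w\<rangle>\<rangle>) -` A"
  have "open V"
    unfolding V_def by (rule continuous_open_preimage[OF hol_curve_on_continuous_speed[OF X U(1)] U(1) A(1)])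
  moreover have "complex_of_real ` I \<subseteq> V"
  proof
    fix w assume "w \<in> complex_of_real ` I"
    then obtain t where t: "t \<in> I" "w = of_real t"
      by blast
    have "X differentiable (at (of_real t))"
      using hol_curve_on_differentiable[OF X U(1)] U(2) t by blast
    then have "du X w = vector_derivative c (at t)"
      using du_eq_vector_derivative[OF I(1) t(1)] complexified_curve_of_real[OF C] t(2)
      by (simp add: X_def)
    then show "w \<in> V"
      using A(2)[OF t(1)] U(2) t by (auto simp: V_def)
  qed
  ultimately obtain M where M: "open M" "connected M" "simply_connected M" "complex_of_real ` I \<subseteq> M" "M \<subseteq> V"
    using simply_connected_neighbourhood[of V I] I by blast
  have ext: "holomorphic_extension c I C M"
    using C M(5) by (auto simp: holomorphic_extension_def V_def intro: holomorphic_on_subset)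
  have fX: "bjorling_map M c C w = X w" if "w \<in> M" for w
    using bjorling_map_coordinates[OF M(1,2,4) I(3) ext that]
    by (simp add: complex_coordinates_eq_iff X_def complexified_curve_def)
  have XM: "hol_curve_on X M"
    using hol_curve_on_complexified_curve[OF ext] by (simp add: X_def)
  have f: "hol_curve_on (bjorling_map M c C) M"
    using XM fX by (simp cong: hol_curve_on_cong)
  have fc: "bjorling_map M c C (of_real t) = c t" if "t \<in> I" for t
    using fX complexified_curve_of_real[OF C that] M(4) that by (simp add: X_def image_subset_iff)
  have "P (bjorling_map M c C) M"
  proof (rule P_I[OF f M(1) _ fc])
    fix w assume w: "w \<in> M"
    have "frechet_derivative X (at w) = frechet_derivative (bjorling_map M c C) (at w)"
      using hol_curve_on_differentiable[OF XM M(1) w] M(1) w fX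
      by (intro frechet_derivative_transform_within_open) auto
    then have "du (bjorling_map M c C) w = du X w"
      by (simp add: du_def)
    then show "\<langle>\<langle>du (bjorling_map M c C) w, du (bjorling_map M c C) w\<rangle>\<rangle> \<in> A"
      using w M(5) by (auto simp: V_def)
  qed
  moreover have "g w = bjorling_map M c C w" if g: "P g M" and w: "w \<in> M" for g w
    using P_D[OF g] fc by (intro hol_curve_on_eq_from_reals[OF M(1,2) _ f I(1,3) M(4) _ w]) (auto simp: M(1))
  moreover have "D w = C w" if D: "holomorphic_extension c I D M" and w: "w \<in> M" for D w
  proof -
    have "D w $ j = C w $ j" for j
      using D ext
      by (intro holomorphic_eq_from_reals[OF M(1,2) _ _ I(1,3) M(4) _ w,
            where f = "\<lambda>w. D w $ j" and g = "\<lambda>w. C w $ j"])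
        (auto simp: holomorphic_extension_def)
    then show ?thesis
      by (simp add: vec_eq_iff)
  qed
  ultimately show ?thesis
    using M ext by (intro exI[of _ M] exI[of _ C]) blast
qed

theorem theorem3p3:
  fixes r :: real and c :: "real \<Rightarrow> real^4" and I :: "real set"
  assumes "r > 0" and "I = {-r<..<r}" and "real_analytic_on c I"
  shows
    "((\<forall>t\<in>I. \<langle>\<langle>vector_derivative c (at t), vector_derivative c (at t)\<rangle>\<rangle> > 0) \<longrightarrow>
      (\<exists>M C. open M \<and> connected M \<and> simply_connected M \<and> complex_of_real ` I \<subseteq> M \<and>
        holomorphic_extension c I C M \<and>
        (\<forall>D. holomorphic_extension c I D M \<longrightarrow> (\<forall>w\<in>M. D w = C w)) \<and>
        bjorling_pos c I (bjorling_map M c C) M \<and>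
        (\<forall>g. bjorling_pos c I g M \<longrightarrow> (\<forall>w\<in>M. g w = bjorling_map M c C w)))) \<and>
     ((\<forall>t\<in>I. \<langle>\<langle>vector_derivative c (at t), vector_derivative c (at t)\<rangle>\<rangle> < 0) \<longrightarrow>
      (\<exists>M C. open M \<and> connected M \<and> simply_connected M \<and> complex_of_real ` I \<subseteq> M \<and>
        holomorphic_extension c I C M \<and>
        (\<forall>D. holomorphic_extension c I D M \<longrightarrow> (\<forall>w\<in>M. D w = C w)) \<and>
        bjorling_neg c I (bjorling_map M c C) M \<and>
        (\<forall>g. bjorling_neg c I g M \<longrightarrow> (\<forall>w\<in>M. g w = bjorling_map M c C w))))"
proof (intro conjI impI)
  have I: "open I" "convex I" "0 \<in> I"
    using assms(1,2) by auto
  show "\<exists>M C. open M \<and> connected M \<and> simply_connected M \<and> complex_of_real ` I \<subseteq> M \<and>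
      holomorphic_extension c I C M \<and>
      (\<forall>D. holomorphic_extension c I D M \<longrightarrow> (\<forall>w\<in>M. D w = C w)) \<and>
      bjorling_pos c I (bjorling_map M c C) M \<and>
      (\<forall>g. bjorling_pos c I g M \<longrightarrow> (\<forall>w\<in>M. g w = bjorling_map M c C w))"
    if "\<forall>t\<in>I. \<langle>\<langle>vector_derivative c (at t), vector_derivative c (at t)\<rangle>\<rangle> > 0"
  proof (rule bjorling_problem_solution[OF assms(3) I open_greaterThan[of 0], where P = "bjorling_pos c I"])
    show "hol_curve_on g M" if "bjorling_pos c I g M" "open M" for g M
      using that by (auto simp: bjorling_pos_def intro: isoclinic_imp_hol_curve_on)
    show "g (of_real t) = c t" if "bjorling_pos c I g M" "t \<in> I" for g M t
      using that by (simp add: bjorling_pos_def)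
  qed (use that in \<open>auto intro: hol_curve_on_bjorling_pos\<close>)
  show "\<exists>M C. open M \<and> connected M \<and> simply_connected M \<and> complex_of_real ` I \<subseteq> M \<and>
      holomorphic_extension c I C M \<and>
      (\<forall>D. holomorphic_extension c I D M \<longrightarrow> (\<forall>w\<in>M. D w = C w)) \<and>
      bjorling_neg c I (bjorling_map M c C) M \<and>
      (\<forall>g. bjorling_neg c I g M \<longrightarrow> (\<forall>w\<in>M. g w = bjorling_map M c C w))"
    if "\<forall>t\<in>I. \<langle>\<langle>vector_derivative c (at t), vector_derivative c (at t)\<rangle>\<rangle> < 0"
  proof (rule bjorling_problem_solution[OF assms(3) I open_lessThan[of 0], where P = "bjorling_neg c I"])
    show "hol_curve_on g M" if "bjorling_neg c I g M" "open M" for g M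
      using that by (auto simp: bjorling_neg_def intro: isoclinic_imp_hol_curve_on)
    show "g (of_real t) = c t" if "bjorling_neg c I g M" "t \<in> I" for g M t
      using that by (simp add: bjorling_neg_def)
  qed (use that in \<open>auto intro: hol_curve_on_bjorling_neg\<close>)
qed

end
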